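(* There exists an absolute constant $C$, and for every $\varepsilon>0$ a constant $C_\varepsilon$ depending only on $\varepsilon$, such that for all odd positive integers $m>n\ge 3$, $$\mathbb P\{R_n\text{ and }R_m\text{ are prime}\}\le \frac{C}{\sqrt{m-n}\,\log n}+C_\varepsilon\, n^{-1/2+\varepsilon}+\frac{C\,\log\log^+(m-n)}{(\log n)^2}.$$
   Context: Rademacher random walk: $R_n=\sum_{k=1}^n\varepsilon_k$, where $\varepsilon_1,\varepsilon_2,\dots$ are i.i.d. with $\mathbb P\{\varepsilon_i=1\}=\mathbb P\{\varepsilon_i=-1\}=1/2$. An integer $r$ (possibly negative) is counted as prime if $|r|$ is a prime number. Here $\log^+x=\max(1,\log x)$ and $\log\log^+x=\log(\log^+x)$. *)

theory Defs
  imports "HOL-Probability.Probability" "HOL-Computational_Algebra.Primes"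
begin

definition rademacher_seq :: "'a measure \<Rightarrow> (nat \<Rightarrow> 'a \<Rightarrow> int) \<Rightarrow> bool" where
  "rademacher_seq M X \<longleftrightarrow>
     prob_space M \<and>
     prob_space.indep_vars M (\<lambda>_. count_space UNIV) X {1..} \<and>
     (\<forall>i\<ge>1. measure M {\<omega> \<in> space M. X i \<omega> = 1} = 1 / 2 \<and>
            measure M {\<omega> \<in> space M. X i \<omega> = -1} = 1 / 2)"

definition rademacher_walk :: "(nat \<Rightarrow> 'a \<Rightarrow> int) \<Rightarrow> nat \<Rightarrow> 'a \<Rightarrow> int" where
  "rademacher_walk X n \<omega> = (\<Sum>k=1..n. X k \<omega>)"

text \<open>The library predicate \<open>prime\<close> on \<^typ>\<open>int\<close> holds only for positive
  integers, hence the absolute value.\<close>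

definition abs_prime :: "int \<Rightarrow> bool" where
  "abs_prime r \<longleftrightarrow> prime \<bar>r\<bar>"

definition log_plus :: "real \<Rightarrow> real" where
  "log_plus x = max 1 (ln x)"

end

theory Submission
  imports Defs "HOL-Number_Theory.Cong"
begin

text \<open>
  Put \<open>N = m - n\<close>, which is even. Given \<open>R\<^sub>m - R\<^sub>n = s\<close>, the event says that \<open>R\<^sub>n\<close> and \<open>R\<^sub>n + s\<close>
  are both prime, and \<open>R\<^sub>n\<close> is independent of \<open>s\<close>. Since consecutive binomial weights have total
  variation \<open>O(1/sqrt n)\<close>, \<open>R\<^sub>n\<close> is equidistributed modulo small odd \<open>q\<close>, and a Selberg sieve with
  level a small power of \<open>n\<close> gives probability \<open>O(1/log n)\<close> for \<open>s = 0\<close> and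
  \<open>O(\<sigma>(s)/(log n)\<^sup>2)\<close> with \<open>\<sigma>(s) = (\<Sum>d | d dvd s. 1/d)\<close> for \<open>s \<noteq> 0\<close>.
  The value \<open>s = 0\<close> has probability \<open>O(1/sqrt N)\<close>. Unimodality of the binomial weights shows that
  a nonzero \<open>s\<close> is divisible by \<open>d\<close> with probability \<open>O(1/d)\<close>, so \<open>\<sigma>(s)\<close> is bounded on average and
  neither \<open>log log\<close> of \<open>s\<close> nor Mertens' theorem enters. As \<open>log log\<^sup>+ N\<close> vanishes for \<open>N = 2\<close>, there
  the \<open>(log n)\<^sup>-\<^sup>2\<close> term is absorbed into the first summand of the claim; for \<open>N \<ge> 4\<close> it is
  absorbed into the third. The constant \<open>C\<^sub>\<epsilon>\<close> can be taken to be 0.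
\<close>

subsection \<open>Symmetric binomial weights\<close>

text \<open>Probability that exactly \<open>j\<close> of \<open>n\<close> fair signs are positive;
  the walk then stands at \<open>2 * j - n\<close>.\<close>

definition half_binom :: "nat \<Rightarrow> nat \<Rightarrow> real" where
  "half_binom n j = real (n choose j) / 2 ^ n"

lemma half_binom_nonneg [simp]: "half_binom n j \<ge> 0"
  by (simp add: half_binom_def)

lemma half_binom_eq_0 [simp]: "n < j \<Longrightarrow> half_binom n j = 0"
  by (simp add: half_binom_def)

lemma half_binom_Bernstein: "j \<le> n \<Longrightarrow> half_binom n j = Bernstein n j (1/2)"
  by (simp add: half_binom_def Bernstein_def power_add[symmetric] power_one_over divide_simps)

lemma sum_half_binom [simp]: "(\<Sum>j\<le>n. half_binom n j) = 1"
  by (simp add: half_binom_Bernstein)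

text \<open>The variance of the walk: the square is expanded in \<open>1\<close>, \<open>j\<close>
  and \<open>j * (j - 1)\<close>, whose Bernstein sums are known.\<close>

lemma half_binom_second_moment:
  "(\<Sum>j\<le>n. half_binom n j * (2 * real j - real n)\<^sup>2) = real n"
proof -
  have "(\<Sum>j\<le>n. half_binom n j * (2 * real j - real n)\<^sup>2) =
      (\<Sum>j\<le>n. 4 * (real j * (real j - 1) * Bernstein n j (1/2))
        + ((4 - 4 * real n) * (real j * Bernstein n j (1/2)) + (real n)\<^sup>2 * Bernstein n j (1/2)))"
    by (intro sum.cong refl) (simp add: half_binom_Bernstein algebra_simps power2_eq_square)
  also have "\<dots> = 4 * (real n * (real n - 1) * (1/2)\<^sup>2)
      + ((4 - 4 * real n) * (real n * (1/2)) + (real n)\<^sup>2 * 1)"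
    by (simp only: sum.distrib sum_distrib_left[symmetric] sum_k_Bernstein sum_kk_Bernstein
        sum_Bernstein)
  also have "\<dots> = real n"
    by (simp add: algebra_simps power2_eq_square)
  finally show ?thesis .
qed

text \<open>AM-GM replaces Cauchy-Schwarz: averaging \<open>x^2 / (2 * r) + r / 2\<close> by means
  of the second moment gives exactly \<open>r\<close> when \<open>r = sqrt n\<close>.\<close>

lemma half_binom_abs_moment:
  "(\<Sum>j\<le>n. half_binom n j * \<bar>2 * real j - real n\<bar>) \<le> sqrt (real n)"
proof (cases "n = 0")
  case False
  define r where "r = sqrt (real n)"
  have r: "r > 0" "r\<^sup>2 = real n"
    using False by (auto simp: r_def)
  have am: "\<bar>x\<bar> \<le> x\<^sup>2 * (1 / (2 * r)) + r / 2" for x :: real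
  proof -
    have "0 \<le> (\<bar>x\<bar> - r)\<^sup>2" by simp
    hence "2 * r * \<bar>x\<bar> \<le> x\<^sup>2 + r\<^sup>2"
      by (simp add: power2_diff algebra_simps)
    thus ?thesis
      using r(1) by (simp add: field_simps power2_eq_square)
  qed
  have "(\<Sum>j\<le>n. half_binom n j * \<bar>2 * real j - real n\<bar>)
      \<le> (\<Sum>j\<le>n. half_binom n j * ((2 * real j - real n)\<^sup>2 * (1 / (2 * r)) + r / 2))"
    by (intro sum_mono mult_left_mono am) auto
  also have "\<dots> = (\<Sum>j\<le>n. half_binom n j * (2 * real j - real n)\<^sup>2 * (1 / (2 * r)) + half_binom n j * (r / 2))"
    by (simp add: algebra_simps)
  also have "\<dots> = real n * (1 / (2 * r)) + 1 * (r / 2)"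
    by (simp only: sum.distrib sum_distrib_right[symmetric] half_binom_second_moment sum_half_binom)
  also have "\<dots> = r"
    using r by (simp add: field_simps power2_eq_square)
  finally show ?thesis by (simp add: r_def)
qed auto

text \<open>By this identity the total variation of the weights for \<open>n\<close> is a first absolute moment for
  \<open>n + 1\<close>, hence \<open>O(1/sqrt n)\<close> without Stirling's formula.\<close>

lemma half_binom_diff:
  "half_binom n j - half_binom n (Suc j)
    = 2 / real (Suc n) * (half_binom (Suc n) (Suc j) * (2 * real (Suc j) - real (Suc n)))"
proof -
  define c where "c = real (Suc n choose Suc j)"
  have "real (Suc j * (Suc n choose Suc j)) = real (Suc n * (n choose j))"
    by (simp only: Suc_times_binomial)
  hence 1: "real (n choose j) = real (Suc j) / real (Suc n) * c"
    unfolding c_def of_nat_mult by (simp add: field_simps del: of_nat_Suc binomial_Suc_Suc)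
  have 2: "real (n choose Suc j) = c - real (n choose j)"
    by (simp add: c_def)
  have 3: "half_binom (Suc n) (Suc j) = c / (2 * 2 ^ n)"
    by (simp add: half_binom_def c_def)
  define r where "r = real (Suc j) / real (Suc n)"
  have 4: "2 * real (Suc j) - real (Suc n) = real (Suc n) * (2 * r - 1)"
    by (simp add: r_def right_diff_distrib del: of_nat_Suc)
  have "half_binom n j - half_binom n (Suc j) = c * (2 * r - 1) / 2 ^ n"
    unfolding half_binom_def 2 1 r_def[symmetric] by (simp add: field_simps)
  also have "\<dots> = 2 / real (Suc n) * (half_binom (Suc n) (Suc j) * (2 * real (Suc j) - real (Suc n)))"
    unfolding 3 4 by (simp del: of_nat_Suc)
  finally show ?thesis .
qed

section \<open>Near invariance under shifts and equidistribution modulo q\<close>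

text \<open>Summation by parts moves the shift from \<open>H\<close> to the weights, whose
  differences are the first-moment terms of \<open>half_binom_diff\<close>.\<close>

lemma half_binom_shift1:
  assumes K: "\<And>j. \<bar>H j\<bar> \<le> K"
  shows "\<bar>(\<Sum>j\<le>n. half_binom n j * H (Suc j)) - (\<Sum>j\<le>n. half_binom n j * H j)\<bar>
          \<le> K * (2 / sqrt (real (Suc n)))"
proof -
  define u where "u j = half_binom (Suc n) j * (2 * real j - real (Suc n))" for j
  \<comment> \<open>The boundary term fits the same formula: it is the difference between a weight 0
    at index -1 and \<open>half_binom n 0\<close>.\<close>
  have 0: "half_binom n 0 = - (2 / real (Suc n) * u 0)"
    by (simp add: half_binom_def u_def divide_simps)
  have "(\<Sum>j\<le>n. half_binom n j * H j) = (\<Sum>j\<le>Suc n. half_binom n j * H j)"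
    by simp
  also have "\<dots> = half_binom n 0 * H 0 + (\<Sum>j\<le>n. half_binom n (Suc j) * H (Suc j))"
    by (subst sum.atMost_Suc_shift) simp
  finally have "(\<Sum>j\<le>n. half_binom n j * H (Suc j)) - (\<Sum>j\<le>n. half_binom n j * H j)
     = (\<Sum>j\<le>n. (half_binom n j - half_binom n (Suc j)) * H (Suc j)) - half_binom n 0 * H 0"
    by (simp add: left_diff_distrib sum_subtractf)
  also have "\<dots> = 2 / real (Suc n) * u 0 * H 0 + (\<Sum>j\<le>n. 2 / real (Suc n) * u (Suc j) * H (Suc j))"
    unfolding half_binom_diff u_def[symmetric] 0 by simp
  also have "\<dots> = (\<Sum>j\<le>Suc n. 2 / real (Suc n) * u j * H j)"
    by (simp only: sum.atMost_Suc_shift)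
  also have "\<bar>\<dots>\<bar> \<le> (\<Sum>j\<le>Suc n. \<bar>2 / real (Suc n) * u j * H j\<bar>)"
    by (rule sum_abs)
  also have "\<dots> \<le> (\<Sum>j\<le>Suc n. 2 / real (Suc n) * (\<bar>u j\<bar> * K))"
    by (intro sum_mono) (use K in \<open>auto simp: abs_mult intro!: divide_right_mono mult_left_mono\<close>)
  also have "\<dots> = 2 / real (Suc n) * K * (\<Sum>j\<le>Suc n. half_binom (Suc n) j * \<bar>2 * real j - real (Suc n)\<bar>)"
    by (simp only: u_def abs_mult abs_of_nonneg[OF half_binom_nonneg] sum_distrib_left mult_ac)
  also have "\<dots> \<le> 2 / real (Suc n) * K * sqrt (real (Suc n))"
    using K[of 0] by (intro mult_left_mono half_binom_abs_moment) auto
  also have "\<dots> = K * (2 / sqrt (real (Suc n)))"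
  proof -
    define r where "r = sqrt (real (Suc n))"
    have r: "r > 0" "real (Suc n) = r * r" by (auto simp: r_def)
    show ?thesis unfolding r_def[symmetric] unfolding r(2) using r(1) by simp
  qed
  finally show ?thesis .
qed

lemma half_binom_shift:
  assumes K: "\<And>j. \<bar>H j\<bar> \<le> K"
  shows "\<bar>(\<Sum>j\<le>n. half_binom n j * H (j + t)) - (\<Sum>j\<le>n. half_binom n j * H j)\<bar>
          \<le> real t * (K * (2 / sqrt (real (Suc n))))"
proof (induction t)
  case (Suc t)
  have "\<bar>(\<Sum>j\<le>n. half_binom n j * H (Suc j + t)) - (\<Sum>j\<le>n. half_binom n j * H (j + t))\<bar>
          \<le> K * (2 / sqrt (real (Suc n)))"
    by (rule half_binom_shift1) (rule K)
  moreover have "real (Suc t) * (K * (2 / sqrt (real (Suc n)))) =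
      real t * (K * (2 / sqrt (real (Suc n)))) + K * (2 / sqrt (real (Suc n)))"
    by (simp add: distrib_right add_divide_distrib)
  ultimately show ?case
    using Suc.IH by simp
qed auto

text \<open>A single weight is the change in the mean of the step function \<open>j < i\<close>
  under a shift by one, so the total variation bounds it.\<close>

lemma half_binom_le: "half_binom n j \<le> 2 / sqrt (real (Suc n))"
proof (cases "j \<le> n")
  case True
  define H :: "nat \<Rightarrow> real" where "H i = of_bool (j < i)" for i
  have "(\<Sum>i\<le>n. half_binom n i * H (Suc i)) - (\<Sum>i\<le>n. half_binom n i * H i)
      = (\<Sum>i\<le>n. if i = j then half_binom n i else 0)"
    unfolding sum_subtractf[symmetric] by (intro sum.cong) (auto simp: H_def)
  also have "\<dots> = half_binom n j"
    using True by simp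
  finally show ?thesis
    using half_binom_shift1[of H 1 n] by (simp add: H_def)
qed auto

lemma sum_periodic_shift:
  fixes H :: "nat \<Rightarrow> real"
  assumes per: "\<And>j. H j = H (j mod q)" and q: "q > 0"
  shows "(\<Sum>t<q. H (j + t)) = (\<Sum>t<q. H t)"
proof (induction j)
  case (Suc j)
  have "(\<Sum>t<q. H (Suc j + t)) = (\<Sum>t<Suc q. H (j + t)) - H j"
    by (subst sum.lessThan_Suc_shift) simp
  also have "\<dots> = (\<Sum>t<q. H (j + t))"
    using per[of "j + q"] per[of j] by simp
  finally show ?case using Suc.IH by simp
qed auto

text \<open>Averaging the expectation over the shifts \<open>t < q\<close> gives the mean over a
  period exactly; each shift changes the expectation by at most \<open>t\<close> times the one-step
  bound.\<close>

lemma half_binom_periodic: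
  fixes H :: "nat \<Rightarrow> real"
  assumes per: "\<And>j. H j = H (j mod q)" and q: "q > 0" and K: "\<And>j. \<bar>H j\<bar> \<le> K"
  shows "\<bar>(\<Sum>j\<le>n. half_binom n j * H j) - (\<Sum>t<q. H t) / real q\<bar>
          \<le> real q * K * (2 / sqrt (real (Suc n)))"
proof -
  let ?V = "2 / sqrt (real (Suc n))"
  let ?E = "\<lambda>t. \<Sum>j\<le>n. half_binom n j * H (j + t)"
  have "(\<Sum>t<q. ?E t) = (\<Sum>j\<le>n. half_binom n j * (\<Sum>t<q. H (j + t)))"
    by (subst sum.swap) (simp add: sum_distrib_left)
  also have "\<dots> = (\<Sum>t<q. H t)"
    using sum_periodic_shift[of H q, OF per q] by (simp add: sum_distrib_right[symmetric])
  finally have eq: "(\<Sum>t<q. ?E t) = (\<Sum>t<q. H t)" .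
  have "real q * \<bar>?E 0 - (\<Sum>t<q. H t) / real q\<bar> = \<bar>real q * ?E 0 - (\<Sum>t<q. H t)\<bar>"
  proof -
    have "real q * \<bar>?E 0 - (\<Sum>t<q. H t) / real q\<bar> = \<bar>real q * (?E 0 - (\<Sum>t<q. H t) / real q)\<bar>"
      by (simp only: abs_mult abs_of_nat)
    also have "real q * (?E 0 - (\<Sum>t<q. H t) / real q) = real q * ?E 0 - (\<Sum>t<q. H t)"
      using q by (simp only: right_diff_distrib) simp
    finally show ?thesis .
  qed
  also have "\<dots> = \<bar>\<Sum>t<q. (?E t - ?E 0)\<bar>"
    unfolding eq[symmetric] sum_subtractf by (simp only: sum_constant card_lessThan abs_minus_commute)
  also have "\<dots> \<le> (\<Sum>t<q. \<bar>?E t - ?E 0\<bar>)"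
    by (rule sum_abs)
  also have "\<dots> \<le> (\<Sum>t<q. real q * (K * ?V))"
  proof (rule sum_mono)
    fix t assume "t \<in> {..<q}"
    have "\<bar>?E t - ?E 0\<bar> \<le> real t * (K * ?V)"
      using half_binom_shift[of H K n t, OF K] by simp
    also have "\<dots> \<le> real q * (K * ?V)"
      using \<open>t \<in> _\<close> K[of 0] by (intro mult_right_mono mult_nonneg_nonneg) auto
    finally show "\<bar>?E t - ?E 0\<bar> \<le> real q * (K * ?V)" .
  qed
  also have "\<dots> = real q * (real q * K * ?V)"
    by simp
  finally show ?thesis
    unfolding add_0_right by (rule mult_left_le_imp_le) (use q in simp)
qed

subsection \<open>A sieve upper bound by duality\<close>

text \<open>Coprimality makes the map to pairs of residues injective, and counting makes it
  surjective; the sum then runs over a rectangle.\<close>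

lemma crt_sum:
  fixes A B :: "nat \<Rightarrow> real"
  assumes cop: "coprime p q" and pos: "p > 0" "q > 0"
    and A: "\<And>x. A x = A (x mod p)" and B: "\<And>x. B x = B (x mod q)"
  shows "(\<Sum>x<p*q. A x * B x) = (\<Sum>x<p. A x) * (\<Sum>x<q. B x)"
proof -
  have inj: "inj_on (\<lambda>x. (x mod p, x mod q)) {..<p*q}"
  proof (rule inj_onI)
    fix x y assume xy: "x \<in> {..<p*q}" "y \<in> {..<p*q}" "(x mod p, x mod q) = (y mod p, y mod q)"
    hence "[x = y] (mod p * q)"
      using cop by (auto simp: cong_def[symmetric] intro: coprime_cong_mult_nat)
    thus "x = y"
      using xy by (simp add: cong_def)
  qed
  have "(\<lambda>x. (x mod p, x mod q)) ` {..<p*q} = {..<p} \<times> {..<q}"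
    using pos by (intro card_subset_eq) (auto simp: card_image[OF inj])
  hence bij: "bij_betw (\<lambda>x. (x mod p, x mod q)) {..<p*q} ({..<p} \<times> {..<q})"
    using inj by (simp add: bij_betw_def)
  have "(\<Sum>x<p*q. A x * B x) = (\<Sum>x<p*q. (\<lambda>(a,b). A a * B b) (x mod p, x mod q))"
    by (intro sum.cong refl) (use A B in auto)
  also have "\<dots> = (\<Sum>(a,b)\<in>{..<p} \<times> {..<q}. A a * B b)"
    by (rule sum.reindex_bij_betw[OF bij])
  also have "\<dots> = (\<Sum>x<p. A x) * (\<Sum>x<q. B x)"
    by (simp add: sum_product sum.cartesian_product)
  finally show ?thesis .
qed

lemma crt_prod_sum:
  fixes f :: "nat \<Rightarrow> nat \<Rightarrow> real"
  assumes "finite P" "\<And>p. p \<in> P \<Longrightarrow> prime p" "\<And>p x. p \<in> P \<Longrightarrow> f p x = f p (x mod p)"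
  shows "(\<Sum>x<\<Prod>P. \<Prod>p\<in>P. f p x) = (\<Prod>p\<in>P. \<Sum>x<p. f p x)"
  using assms
proof (induction P rule: finite_induct)
  case (insert q P)
  have q: "prime q" using insert.prems by auto
  have per: "(\<Prod>p\<in>P. f p x) = (\<Prod>p\<in>P. f p (x mod \<Prod>P))" for x
  proof (intro prod.cong refl)
    fix p assume p: "p \<in> P"
    have "p dvd \<Prod>P" using p insert.hyps by (intro dvd_prodI[of P p "\<lambda>x. x", simplified]) auto
    hence "x mod \<Prod>P mod p = x mod p" by (rule mod_mod_cancel)
    thus "f p x = f p (x mod \<Prod>P)"
      using insert.prems(2)[of p] p by (metis insertCI)
  qed
  have "coprime q (\<Prod>P)"
  proof (rule prod_coprime_right)
    fix p assume "p \<in> P"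
    thus "coprime q p"
      using insert.hyps insert.prems(1)[of p] q by (metis insertCI primes_coprime)
  qed
  moreover have "\<Prod>P > 0"
    using insert.prems by (intro prod_pos) (auto intro: prime_gt_0_nat)
  ultimately have "(\<Sum>x<q * \<Prod>P. f q x * (\<Prod>p\<in>P. f p x)) = (\<Sum>x<q. f q x) * (\<Sum>x<\<Prod>P. \<Prod>p\<in>P. f p x)"
    using q per insert.prems(2)[of q] by (intro crt_sum) (auto simp: prime_gt_0_nat)
  also have "(\<Sum>x<\<Prod>P. \<Prod>p\<in>P. f p x) = (\<Prod>p\<in>P. \<Sum>x<p. f p x)"
    by (rule insert.IH) (rule insert.prems, simp)+
  finally show ?case
    using insert.hyps by simp
qed auto

lemma prime_factors_prod_primes:
  fixes T :: "nat set"
  assumes "finite T" "\<And>p. p \<in> T \<Longrightarrow> prime p"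
  shows "prime_factors (\<Prod>T) = T"
proof -
  have "prime_factors (\<Prod>T) = \<Union>((prime_factors \<circ> (\<lambda>p. p)) ` T)"
    using assms by (intro prime_factors_prod) (auto dest: prime_gt_0_nat)
  also have "\<dots> = T"
    using assms(2) by (auto simp: prime_prime_factors)
  finally show ?thesis .
qed

text \<open>
  On \<open>\<int>/p\<close> the function \<open>h p\<close>, equal to \<open>-1\<close> on \<open>\<Omega> p\<close> and to \<open>g p\<close> elsewhere, has mean 0 and second
  moment \<open>g p\<close>. So the products of the \<open>h p\<close> over the sets \<open>T \<in> D\<close> are nearly orthogonal, their sum \<open>F\<close>
  has second moment about \<open>G\<close>, and \<open>F = G\<close> at every sifted point: the bound is Chebyshev's
  inequality for \<open>F\<close>. Squarefree moduli are represented by their sets of prime factors.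
\<close>

lemma selberg_sieve:
  fixes \<Omega> :: "nat \<Rightarrow> nat \<Rightarrow> bool" and P :: "nat set" and D :: "nat set set" and z n :: nat
  defines "\<rho> \<equiv> \<lambda>p. card {j \<in> {..<p}. \<Omega> p j}"
  defines "g \<equiv> \<lambda>p. real (\<rho> p) / (real p - real (\<rho> p))"
  defines "G \<equiv> \<Sum>T\<in>D. \<Prod>p\<in>T. g p"
  assumes P: "finite P" "\<And>p. p \<in> P \<Longrightarrow> prime p"
    and per: "\<And>p j. p \<in> P \<Longrightarrow> \<Omega> p j = \<Omega> p (j mod p)"
    and \<rho>: "\<And>p. p \<in> P \<Longrightarrow> \<rho> p < p"
    and D: "D \<subseteq> Pow P" "{} \<in> D" "\<And>T. T \<in> D \<Longrightarrow> \<Prod>T \<le> z"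
  shows "(\<Sum>j\<le>n. half_binom n j * of_bool (\<forall>p\<in>P. \<not> \<Omega> p j)) \<le> 1 / G + real z ^ 6 * (2 / sqrt (real (Suc n)))"
proof -
  define V where "V = 2 / sqrt (real (Suc n))"
  define h where "h = (\<lambda>p j. if \<Omega> p j then -1 else g p)"
  define W where "W = (\<lambda>T j. \<Prod>p\<in>T. h p j)"
  define F where "F = (\<lambda>j. \<Sum>T\<in>D. W T j)"
  have V: "V \<ge> 0" by (simp add: V_def)
  have finD: "finite D" using D(1) P(1) by (meson finite_Pow_iff finite_subset)
  have T_P: "finite T" "T \<subseteq> P" if "T \<in> D" for T
    using that D(1) P(1) by (auto intro: finite_subset)
  have P0: "p > 0" if "p \<in> P" for p using prime_gt_0_nat P(2) that by blast
  have T_pos: "\<Prod>T > 0" if "T \<in> D" for T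
    using T_P(2)[OF that] P0 by (intro prod_pos) auto
  \<comment> \<open>Since \<open>\<rho> p < p\<close> are integers, the denominator is at least 1.
    The crude bound by \<open>p\<close> suffices, as it yields
    \<open>\<bar>W T j\<bar> \<le> \<Prod>T \<le> z\<close>.\<close>
  have g0: "g p \<ge> 0" and gp: "g p \<le> real p" if "p \<in> P" for p
  proof -
    have 1: "1 \<le> real p - real (\<rho> p)" using \<rho>[OF that] by linarith
    thus "g p \<ge> 0" by (simp add: g_def)
    have "real (\<rho> p) / (real p - real (\<rho> p)) \<le> real (\<rho> p) / 1"
      using 1 by (intro divide_left_mono) auto
    thus "g p \<le> real p" using \<rho>[OF that] by (simp add: g_def)
  qed
  have h_abs: "\<bar>h p j\<bar> \<le> real p" if "p \<in> P" for p j
    using g0[OF that] gp[OF that] prime_gt_0_nat[OF P(2)[OF that]] by (auto simp: h_def)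
  have h_per: "h p j = h p (j mod p)" if "p \<in> P" for p j
    using per[OF that, of j] by (simp add: h_def)
  have split: "(\<Sum>x<p. if \<Omega> p x then a else b) = real (\<rho> p) * a + (real p - real (\<rho> p)) * b"
    if "p \<in> P" for p and a b :: real
  proof -
    let ?A = "{x \<in> {..<p}. \<Omega> p x}" and ?B = "{x \<in> {..<p}. \<not> \<Omega> p x}"
    have AB: "{..<p} = ?A \<union> ?B" by auto
    have "card {..<p} = card ?A + card ?B"
      by (subst AB, rule card_Un_disjoint) auto
    hence B: "real (card ?B) = real p - real (\<rho> p)" by (simp add: \<rho>_def)
    have "(\<Sum>x<p. if \<Omega> p x then a else b) = (\<Sum>x\<in>?A. if \<Omega> p x then a else b) + (\<Sum>x\<in>?B. if \<Omega> p x then a else b)"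
      by (subst AB, rule sum.union_disjoint) auto
    also have "\<dots> = (\<Sum>x\<in>?A. a) + (\<Sum>x\<in>?B. b)"
      by (intro arg_cong2[where f = "(+)"] sum.cong) auto
    finally show ?thesis
      using B by (simp add: \<rho>_def)
  qed
  have mean1: "(\<Sum>x<p. h p x) = 0" if "p \<in> P" for p
    using split[OF that, of "-1" "g p"] \<rho>[OF that] by (simp add: h_def g_def)
  have mean2: "(\<Sum>x<p. h p x * h p x) = real p * g p" if "p \<in> P" for p
  proof -
    have ne: "real p - real (\<rho> p) \<noteq> 0" using \<rho>[OF that] by simp
    have "(\<Sum>x<p. h p x * h p x) = (\<Sum>x<p. if \<Omega> p x then 1 else g p * g p)"
      by (intro sum.cong) (auto simp: h_def)
    also have "\<dots> = real (\<rho> p) + (real p - real (\<rho> p)) * g p * g p"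
      unfolding split[OF that] by simp
    also have "(real p - real (\<rho> p)) * g p = real (\<rho> p)"
      using ne by (simp add: g_def)
    also have "real (\<rho> p) + real (\<rho> p) * g p = real p * g p"
      using ne by (simp add: g_def field_simps)
    finally show ?thesis .
  qed

  \<comment> \<open>By unique factorization \<open>T\<close> can be recovered from
    \<open>\<Prod>T\<close>, so \<open>D\<close> injects into \<open>{1..z}\<close>.\<close>
  have card_D: "card D \<le> z"
  proof -
    have "inj_on (\<lambda>T. \<Prod>T) D"
    proof (rule inj_onI)
      fix S T assume "S \<in> D" "T \<in> D" "\<Prod>S = \<Prod>T"
      thus "S = T"
        using prime_factors_prod_primes[of S] prime_factors_prod_primes[of T] T_P P(2) by (metis subsetD)
    qed
    moreover have "(\<lambda>T. \<Prod>T) ` D \<subseteq> {1..z}"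
      using D(3) T_pos by (auto simp: Suc_le_eq)
    ultimately show ?thesis
      using card_inj_on_le[of "\<lambda>T. \<Prod>T" D "{1..z}"] by simp
  qed

  have W_abs: "\<bar>W T j\<bar> \<le> real z" if "T \<in> D" for T j
  proof -
    have "\<bar>W T j\<bar> \<le> (\<Prod>p\<in>T. real p)"
      unfolding W_def abs_prod using T_P(2)[OF that] h_abs by (intro prod_mono) auto
    also have "\<dots> = real (\<Prod>T)" by simp
    also have "\<dots> \<le> real z" using D(3)[OF that] by (simp del: of_nat_prod)
    finally show ?thesis .
  qed

  \<comment> \<open>Near-orthogonality: the product has period
    \<open>\<Prod>(S \<union> T) \<le> z^2\<close> and size at most \<open>z^2\<close>, so replacing
    its expectation by its mean over a period costs at most \<open>z^4 * V\<close>.\<close>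
  have corr: "(\<Sum>j\<le>n. half_binom n j * (W S j * W T j)) \<le> (if S = T then \<Prod>p\<in>T. g p else 0) + real z ^ 4 * V"
    if ST: "S \<in> D" "T \<in> D" for S T
  proof -
    define U where "U = S \<union> T"
    \<comment> \<open>Padding with factors 1 writes both products over the common index set
      \<open>U\<close>, so that the Chinese remainder theorem factors the mean.\<close>
    define \<phi> where "\<phi> = (\<lambda>p j. (if p \<in> S then h p j else 1) * (if p \<in> T then h p j else 1))"
    have U: "finite U" "U \<subseteq> P" using T_P[OF ST(1)] T_P[OF ST(2)] by (auto simp: U_def)
    have q_pos: "\<Prod>U > 0"
      using U P0 by (intro prod_pos) auto
    have WW: "W S j * W T j = (\<Prod>p\<in>U. \<phi> p j)" for j
    proof -
      have "(\<Prod>p\<in>U. if p \<in> S then h p j else 1) = W S j" "(\<Prod>p\<in>U. if p \<in> T then h p j else 1) = W T j"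
        unfolding W_def U_def
        using T_P[OF ST(1)] T_P[OF ST(2)] by (auto simp: prod.inter_restrict[symmetric] Int_absorb1 Int_Un_distrib2 intro!: prod.cong)
      thus ?thesis unfolding \<phi>_def prod.distrib by simp
    qed
    have \<phi>_per: "\<phi> p x = \<phi> p (x mod p)" if "p \<in> U" for p x
      using h_per[of p x] that U(2) by (auto simp: \<phi>_def)
    have per_q: "(\<Prod>p\<in>U. \<phi> p x) = (\<Prod>p\<in>U. \<phi> p (x mod \<Prod>U))" for x
    proof (intro prod.cong refl)
      fix p assume p: "p \<in> U"
      have "p dvd \<Prod>U" using p U(1) by (intro dvd_prodI[of U p "\<lambda>x. x", simplified]) auto
      hence "x mod \<Prod>U mod p = x mod p" by (rule mod_mod_cancel)
      thus "\<phi> p x = \<phi> p (x mod \<Prod>U)"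
        using \<phi>_per[OF p] by metis
    qed
    have K: "\<bar>\<Prod>p\<in>U. \<phi> p j\<bar> \<le> real z * real z" for j
      unfolding WW[symmetric] abs_mult using W_abs[OF ST(1), of j] W_abs[OF ST(2), of j]
      by (intro mult_mono) auto
    have mean: "(\<Sum>x<\<Prod>U. \<Prod>p\<in>U. \<phi> p x) / real (\<Prod>U) = (if S = T then \<Prod>p\<in>T. g p else 0)"
    proof -
      have eq: "(\<Sum>x<\<Prod>U. \<Prod>p\<in>U. \<phi> p x) = (\<Prod>p\<in>U. \<Sum>x<p. \<phi> p x)"
        by (rule crt_prod_sum[of U \<phi>, OF U(1) _ \<phi>_per]) (use U P(2) in auto)
      show ?thesis
      proof (cases "S = T")
        case True
        have "(\<Prod>p\<in>U. \<Sum>x<p. \<phi> p x) = (\<Prod>p\<in>U. real p * g p)"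
          using U(2) mean2 True by (intro prod.cong) (auto simp: \<phi>_def U_def)
        also have "\<dots> = real (\<Prod>U) * (\<Prod>p\<in>T. g p)"
          using True by (simp add: prod.distrib U_def)
        finally show ?thesis using eq q_pos True by (simp del: of_nat_prod)
      next
        case False
        \<comment> \<open>A prime in only one of \<open>S\<close> and \<open>T\<close> contributes
          the mean of \<open>h p\<close>, which is 0.\<close>
        then obtain p where p: "p \<in> U" "p \<notin> S \<or> p \<notin> T" by (auto simp: U_def)
        have "(\<Sum>x<p. \<phi> p x) = (\<Sum>x<p. h p x)"
          using p by (intro sum.cong) (auto simp: \<phi>_def U_def)
        also have "\<dots> = 0" using p U(2) mean1 by auto
        finally have "(\<Prod>p\<in>U. \<Sum>x<p. \<phi> p x) = 0"
          using p(1) U(1) by (intro prod_zero) auto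
        thus ?thesis using eq False by simp
      qed
    qed
    have q_le: "\<Prod>U \<le> z * z"
    proof -
      have "\<Prod>(S \<inter> T) > 0"
        using T_P[OF ST(1)] P0 by (intro prod_pos) auto
      hence "\<Prod>U \<le> \<Prod>U * \<Prod>(S \<inter> T)" by simp
      also have "\<dots> = \<Prod>S * \<Prod>T"
        unfolding U_def using T_P[OF ST(1)] T_P[OF ST(2)] by (intro prod.union_inter)
      also have "\<dots> \<le> z * z"
        using D(3) ST by (intro mult_le_mono) auto
      finally show ?thesis .
    qed
    have "(\<Sum>j\<le>n. half_binom n j * (W S j * W T j)) \<le> (if S = T then \<Prod>p\<in>T. g p else 0)
        + real (\<Prod>U) * (real z * real z) * V"
      using half_binom_periodic[of "\<lambda>j. \<Prod>p\<in>U. \<phi> p j" "\<Prod>U" "real z * real z" n, OF per_q q_pos K]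
      unfolding mean WW V_def by linarith
    also have "real (\<Prod>U) * (real z * real z) * V \<le> real (z * z) * (real z * real z) * V"
      using q_le V by (intro mult_right_mono) (auto simp del: of_nat_prod of_nat_mult)
    also have "\<dots> = real z ^ 4 * V" by (simp add: power_numeral_reduce)
    finally show ?thesis by simp
  qed

  have G1: "G \<ge> 1"
  proof -
    have "(\<Sum>T\<in>{{}}. \<Prod>p\<in>T. g p) \<le> G"
      unfolding G_def using D(2) finD T_P(2) g0 by (intro sum_mono2) (auto intro!: prod_nonneg)
    thus ?thesis by simp
  qed
  have sifted: "F j = G" if "\<forall>p\<in>P. \<not> \<Omega> p j" for j
    unfolding F_def G_def W_def using that T_P(2)
    by (intro sum.cong prod.cong refl) (auto simp: h_def)
  have "G\<^sup>2 * (\<Sum>j\<le>n. half_binom n j * of_bool (\<forall>p\<in>P. \<not> \<Omega> p j)) \<le> (\<Sum>j\<le>n. half_binom n j * (F j)\<^sup>2)"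
    unfolding sum_distrib_left using sifted by (intro sum_mono) auto
  also have "\<dots> = (\<Sum>S\<in>D. \<Sum>T\<in>D. \<Sum>j\<le>n. half_binom n j * (W S j * W T j))"
  proof -
    have "(\<Sum>j\<le>n. half_binom n j * (F j)\<^sup>2) = (\<Sum>j\<le>n. \<Sum>S\<in>D. \<Sum>T\<in>D. half_binom n j * (W S j * W T j))"
      unfolding F_def power2_eq_square sum_product by (simp only: sum_distrib_left)
    also have "\<dots> = (\<Sum>S\<in>D. \<Sum>j\<le>n. \<Sum>T\<in>D. half_binom n j * (W S j * W T j))"
      by (rule sum.swap)
    also have "\<dots> = (\<Sum>S\<in>D. \<Sum>T\<in>D. \<Sum>j\<le>n. half_binom n j * (W S j * W T j))"
      by (intro sum.cong refl sum.swap)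
    finally show ?thesis .
  qed
  also have "\<dots> \<le> (\<Sum>S\<in>D. \<Sum>T\<in>D. (if S = T then \<Prod>p\<in>T. g p else 0) + real z ^ 4 * V)"
    by (intro sum_mono corr)
  also have "\<dots> = G + real (card D) * real (card D) * (real z ^ 4 * V)"
    using finD by (simp add: sum.distrib G_def)
  \<comment> \<open>There are at most \<open>z^2\<close> pairs \<open>S\<close>, \<open>T\<close>,
    which raises the error from \<open>z^4\<close> to \<open>z^6\<close>.\<close>
  also have "\<dots> \<le> G + real z * real z * (real z ^ 4 * V)"
    using card_D V by (intro add_left_mono mult_mono) auto
  also have "\<dots> = G + real z ^ 6 * V" by (simp add: power_numeral_reduce)
  finally have "(\<Sum>j\<le>n. half_binom n j * of_bool (\<forall>p\<in>P. \<not> \<Omega> p j)) \<le> (G + real z ^ 6 * V) / G\<^sup>2"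
    using G1 by (simp add: field_simps)
  also have "\<dots> = 1 / G + real z ^ 6 * V / G\<^sup>2"
    using G1 by (simp add: field_simps power2_eq_square)
  also have "real z ^ 6 * V / G\<^sup>2 \<le> real z ^ 6 * V / 1"
    using G1 V by (intro divide_left_mono) auto
  finally show ?thesis by (simp add: V_def)
qed

subsection \<open>Lower bound for the density sum\<close>

text \<open>The sum-of-divisors function divided by \<open>s\<close>. At \<open>s = 0\<close> the
  divisor set is infinite and the value is the default 0.\<close>

definition inv_divisor_sum :: "nat \<Rightarrow> real" where
  "inv_divisor_sum s = (\<Sum>d | d dvd s. 1 / real d)"

lemma inv_divisor_sum_ge_1: "s > 0 \<Longrightarrow> inv_divisor_sum s \<ge> 1"
proof -
  assume "s > 0"
  hence "(\<Sum>d\<in>{1}. 1 / real d) \<le> inv_divisor_sum s"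
    unfolding inv_divisor_sum_def by (intro sum_mono2) auto
  thus ?thesis by simp
qed

text \<open>The sieve's \<open>g p\<close> for a prime pair at distance \<open>s\<close>: the two
  forbidden classes modulo an odd prime \<open>p\<close> coincide exactly when \<open>p\<close>
  divides \<open>s\<close>.\<close>

definition sieve_density :: "nat \<Rightarrow> nat \<Rightarrow> real" where
  "sieve_density s p = (if p dvd s then 1 / (real p - 1) else 2 / (real p - 2))"

lemma sum_inverse_squares_le: "(\<Sum>e=1..w. 1 / (real e)\<^sup>2) \<le> 2"
proof -
  \<comment> \<open>The bound is sharpened by the telescoping remainder so that the induction
    closes.\<close>
  have "(\<Sum>e=1..Suc w. 1 / (real e)\<^sup>2) \<le> 2 - 1 / real (Suc w)" for w
  proof (induction w)
    case (Suc w)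
    have "1 / (real (Suc (Suc w)))\<^sup>2 \<le> 1 / (real (Suc w) * real (Suc (Suc w)))"
      by (intro divide_left_mono) (auto simp: power2_eq_square intro!: mult_right_mono)
    also have "\<dots> = 1 / real (Suc w) - 1 / real (Suc (Suc w))"
      by (simp add: field_simps)
    finally show ?case using Suc.IH by simp
  qed auto
  from this[of "w - 1"] show ?thesis
    by (cases w) (auto intro: order_trans)
qed

section \<open>Harmonic sums over integers coprime to s\<close>

text \<open>Primes shared with \<open>s\<close> are stripped from \<open>k\<close> one at a time.
  Such a prime joins \<open>d\<close>, unless it already divides \<open>d\<close>; then the two
  copies move into the square, and the smaller \<open>d\<close> still divides
  \<open>s\<close>.\<close>

lemma coprime_divisor_square_decomp:
  fixes k s :: nat
  assumes "k > 0"
  shows "\<exists>b d e. k = b * d * e\<^sup>2 \<and> coprime b s \<and> d dvd s"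
  using assms
proof (induction k rule: less_induct)
  case (less k)
  show ?case
  proof (cases "coprime k s")
    case True
    hence "k = k * 1 * 1\<^sup>2 \<and> coprime k s \<and> 1 dvd s" by simp
    thus ?thesis by blast
  next
    case False
    then obtain p where p: "prime p" "p dvd k" "p dvd s"
      using prime_factor_nat[of "gcd k s"] by (auto simp: coprime_iff_gcd_eq_1)
    then obtain k' where k': "k = p * k'" by auto
    have "k' < k" "k' > 0"
      using less.prems k' prime_gt_1_nat[OF p(1)] by auto
    then obtain b d e where bde: "k' = b * d * e\<^sup>2" "coprime b s" "d dvd s"
      using less.IH by blast
    show ?thesis
    proof (cases "p dvd d")
      case True
      then obtain d' where d': "d = p * d'" by auto
      hence "k = b * d' * (p * e)\<^sup>2" "d' dvd s"
        using bde k' by (auto simp: power2_eq_square intro: dvd_trans)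
      thus ?thesis using bde by blast
    next
      case False
      hence "p * d dvd s"
        using p bde by (simp add: divides_mult prime_imp_coprime)
      moreover have "k = b * (p * d) * e\<^sup>2" using bde k' by simp
      ultimately show ?thesis using bde by blast
    qed
  qed
qed

text \<open>Every \<open>k \<le> w\<close> is some \<open>b * d * e^2\<close>, so the harmonic sum
  is dominated by a product of three sums; the one over squares supplies the factor 2.\<close>

lemma harm_le_coprime_sum:
  fixes s w :: nat
  assumes "s > 0"
  shows "harm w \<le> 2 * (\<Sum>b | b \<in> {1..w} \<and> coprime b s. 1 / real b) * inv_divisor_sum s"
proof -
  define B where "B = {b \<in> {1..w}. coprime b s}"
  define Dv where "Dv = {d. d dvd s}"
  have fin: "finite B" "finite Dv" using assms by (auto simp: B_def Dv_def)
  have "(harm w :: real) = (\<Sum>k=1..w. 1 / real k)"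
    by (simp add: harm_def inverse_eq_divide)
  also have "\<dots> \<le> (\<Sum>(b,d,e)\<in>B \<times> Dv \<times> {1..w}. 1 / real b * (1 / real d * (1 / (real e)\<^sup>2)))"
  proof (rule sum_le_included[where i = "\<lambda>(b,d,e). b * d * e\<^sup>2"])
    show "\<forall>x\<in>{1..w}. \<exists>y\<in>B \<times> Dv \<times> {1..w}. (case y of (b, d, e) \<Rightarrow> b * d * e\<^sup>2) = x \<and>
       1 / real x \<le> (case y of (b, d, e) \<Rightarrow> 1 / real b * (1 / real d * (1 / (real e)\<^sup>2)))"
    proof
      fix k assume k: "k \<in> {1..w}"
      then obtain b d e where bde: "k = b * d * e\<^sup>2" "coprime b s" "d dvd s"
        using coprime_divisor_square_decomp[of k s] by auto
      have pos: "b > 0" "d > 0" "e > 0" using k bde(1) by (auto intro!: Nat.gr0I)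
      have "b dvd k" "e dvd k" unfolding bde(1) by (auto simp: power2_eq_square)
      hence "b \<le> w" "e \<le> w" using k by (auto dest!: dvd_imp_le)
      hence "(b, d, e) \<in> B \<times> Dv \<times> {1..w}"
        using bde pos by (auto simp: B_def Dv_def)
      moreover have "1 / real k \<le> 1 / real b * (1 / real d * (1 / (real e)\<^sup>2))"
        unfolding bde(1) by simp
      ultimately show "\<exists>y\<in>B \<times> Dv \<times> {1..w}. (case y of (b, d, e) \<Rightarrow> b * d * e\<^sup>2) = k \<and>
         1 / real k \<le> (case y of (b, d, e) \<Rightarrow> 1 / real b * (1 / real d * (1 / (real e)\<^sup>2)))"
        using bde(1) by (intro bexI[of _ "(b, d, e)"]) auto
    qed
  qed (use fin in auto)
  also have "\<dots> = (\<Sum>b\<in>B. 1 / real b) * ((\<Sum>d\<in>Dv. 1 / real d) * (\<Sum>e=1..w. 1 / (real e)\<^sup>2))"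
    by (simp only: sum_product sum.cartesian_product) (simp add: case_prod_unfold sum_distrib_left)
  also have "\<dots> \<le> (\<Sum>b\<in>B. 1 / real b) * ((\<Sum>d\<in>Dv. 1 / real d) * 2)"
    by (intro mult_left_mono sum_inverse_squares_le) (auto intro!: sum_nonneg)
  finally show ?thesis
    by (simp add: B_def Dv_def inv_divisor_sum_def mult_ac)
qed

section \<open>Euler factors of the density sum\<close>

lemma prod_multiplicity_superset:
  fixes a :: nat
  assumes "a > 0" "finite T" "\<And>p. p \<in> T \<Longrightarrow> prime p" "prime_factors a \<subseteq> T"
  shows "(\<Prod>p\<in>T. p ^ multiplicity p a) = a"
proof -
  have "(\<Prod>p\<in>T. p ^ multiplicity p a) = (\<Prod>p\<in>prime_factors a. p ^ multiplicity p a)"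
    using assms by (intro prod.mono_neutral_right)
      (auto simp: prime_factors_multiplicity not_dvd_imp_multiplicity_0 in_prime_factors_iff)
  thus ?thesis using assms(1) by (simp add: prod_prime_factors)
qed

lemma geometric_sum_le:
  fixes x :: real
  assumes "0 \<le> x" "x < 1"
  shows "(\<Sum>i\<le>w. x ^ i) \<le> 1 / (1 - x)"
proof -
  have "(\<Sum>i\<le>w. x ^ i) = (1 - x ^ Suc w) / (1 - x)"
    using assms sum_gp0[of x w] by auto
  also have "\<dots> \<le> 1 / (1 - x)"
    using assms by (intro divide_right_mono) auto
  finally show ?thesis .
qed

text \<open>\<open>E\<close> lists the possible exponents of \<open>p\<close> in a pair
  \<open>(a, b)\<close> with \<open>p\<close> dividing \<open>a * b\<close> and \<open>b\<close>
  coprime to \<open>s\<close>. Restoring \<open>(0, 0)\<close> completes it to a box, whose sum is a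
  truncated geometric series or its square; what remains is to subtract 1.\<close>

lemma sieve_density_ge:
  fixes p s w :: nat
  assumes p: "p \<ge> 3"
  defines "E \<equiv> {(i, j) \<in> {..w} \<times> {..w}. (i, j) \<noteq> (0, 0) \<and> (p dvd s \<longrightarrow> j = 0)}"
  shows "(\<Sum>(i, j)\<in>E. (1 / real p) ^ i * (1 / real p) ^ j) \<le> sieve_density s p"
proof -
  define x where "x = 1 / real p"
  define S where "S = (\<Sum>i\<le>w. x ^ i)"
  have x: "0 \<le> x" "x < 1" using p by (auto simp: x_def)
  have S: "S \<le> real p / (real p - 1)"
    using geometric_sum_le[OF x, of w] p by (simp add: S_def x_def field_simps)
  have S0: "S \<ge> 0" unfolding S_def using x by (intro sum_nonneg) auto
  show ?thesis
  proof (cases "p dvd s")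
    case True
    have "(\<Sum>(i, j)\<in>insert (0, 0) E. x ^ i * x ^ j) = (\<Sum>(i, j)\<in>{..w} \<times> {0::nat}. x ^ i * x ^ j)"
      using True by (intro sum.cong) (auto simp: E_def)
    also have "\<dots> = S"
      by (simp add: S_def sum.cartesian_product[symmetric])
    also have "(\<Sum>(i, j)\<in>insert (0, 0) E. x ^ i * x ^ j) = 1 + (\<Sum>(i, j)\<in>E. x ^ i * x ^ j)"
      by (subst sum.insert) (auto simp: E_def intro: finite_subset[of _ "{..w} \<times> {..w}"])
    finally have "(\<Sum>(i, j)\<in>E. x ^ i * x ^ j) \<le> real p / (real p - 1) - 1"
      using S by simp
    also have "\<dots> = 1 / (real p - 1)" using p by (simp add: field_simps)
    finally show ?thesis using True by (simp add: sieve_density_def x_def)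
  next
    case False
    have "(\<Sum>(i, j)\<in>insert (0, 0) E. x ^ i * x ^ j) = (\<Sum>(i, j)\<in>{..w} \<times> {..w}. x ^ i * x ^ j)"
      using False by (intro sum.cong) (auto simp: E_def)
    also have "\<dots> = S * S"
      by (simp add: S_def sum_product sum.cartesian_product)
    also have "(\<Sum>(i, j)\<in>insert (0, 0) E. x ^ i * x ^ j) = 1 + (\<Sum>(i, j)\<in>E. x ^ i * x ^ j)"
      by (subst sum.insert) (auto simp: E_def intro: finite_subset[of _ "{..w} \<times> {..w}"])
    finally have "(\<Sum>(i, j)\<in>E. x ^ i * x ^ j) = S * S - 1" by simp
    also have "S * S \<le> (real p / (real p - 1)) * (real p / (real p - 1))"
      using S S0 p by (intro mult_mono) auto
    also have "(real p / (real p - 1)) * (real p / (real p - 1)) - 1 \<le> 2 / (real p - 2)"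
    proof -
      define y where "y = real p - 1"
      have y: "y \<ge> 2" "real p = y + 1" using p by (auto simp: y_def)
      have "(y + 1) / y * ((y + 1) / y) - 1 = (2 * y + 1) / (y * y)"
        using y(1) by (simp add: field_simps)
      also have "\<dots> \<le> 2 / (y - 1)"
      proof -
        have "(2 * y + 1) * (y - 1) \<le> 2 * (y * y)"
          using y(1) by (simp add: algebra_simps)
        thus ?thesis using y(1) by (simp add: pos_divide_le_eq pos_le_divide_eq)
      qed
      finally show ?thesis unfolding y(2) by simp
    qed
    finally show ?thesis using False by (simp add: sieve_density_def x_def)
  qed
qed

text \<open>The fiber over \<open>T\<close> of the map sending \<open>(a, b)\<close> to the prime factors of \<open>a * b\<close> embeds, through
  the exponents of the primes in \<open>T\<close>, into a product of index sets, each contributing at most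
  \<open>sieve_density s p\<close>.\<close>

lemma sieve_density_sum_ge:
  fixes s w :: nat
  defines "P \<equiv> {p. prime p \<and> odd p \<and> p \<le> w * w}"
  defines "D \<equiv> {T. T \<subseteq> P \<and> \<Prod>T \<le> w * w}"
  defines "A \<equiv> {a \<in> {1..w}. odd a}"
  defines "B \<equiv> {b \<in> {1..w}. odd b \<and> coprime b s}"
  shows "(\<Sum>a\<in>A. 1 / real a) * (\<Sum>b\<in>B. 1 / real b) \<le> (\<Sum>T\<in>D. \<Prod>p\<in>T. sieve_density s p)"
proof -
  have finP: "finite P" unfolding P_def by (rule finite_subset[of _ "{..w*w}"]) auto
  have finD: "finite D" unfolding D_def
    by (rule finite_subset[of _ "Pow P"]) (use finP in auto)
  have finA: "finite A" and finB: "finite B" by (auto simp: A_def B_def)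
  define rd :: "nat \<times> nat \<Rightarrow> nat set" where "rd = (\<lambda>(a, b). prime_factors (a * b))"
  have rd_D: "rd y \<in> D" if y_in: "y \<in> A \<times> B" for y
  proof -
    obtain a b where y: "y = (a, b)" "a \<in> A" "b \<in> B" using y_in by (rule SigmaE)
    have ab: "a * b > 0" "odd (a * b)" "a * b \<le> w * w"
      using y by (auto simp: A_def B_def intro: mult_le_mono)
    \<comment> \<open>The radical of \<open>a * b\<close> divides \<open>a * b\<close>, hence stays
      below the level \<open>w * w\<close>.\<close>
    have "\<Prod>(prime_factors (a * b)) dvd (\<Prod>p\<in>prime_factors (a * b). p ^ multiplicity p (a * b))"
      using ab(1) by (intro prod_dvd_prod) (auto simp: prime_factors_multiplicity)
    also have "\<dots> = a * b" using ab(1) by (simp only: prime_factorization_nat[symmetric])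
    finally have "\<Prod>(prime_factors (a * b)) \<le> a * b"
      using ab(1) by (intro dvd_imp_le)
    moreover have "prime_factors (a * b) \<subseteq> P"
    proof
      fix p assume p: "p \<in> prime_factors (a * b)"
      hence pd: "prime p" "p dvd a * b" by auto
      have "p \<le> a * b" using pd(2) ab(1) by (rule dvd_imp_le)
      moreover have "odd p" using pd(2) ab(2) by (meson dvd_trans)
      ultimately show "p \<in> P" using pd(1) ab(3) unfolding P_def by simp
    qed
    ultimately show ?thesis
      using ab(3) unfolding D_def rd_def y(1) by simp
  qed
  have fiber: "(\<Sum>(a, b) | (a, b) \<in> A \<times> B \<and> rd (a, b) = T. 1 / real a * (1 / real b)) \<le> (\<Prod>p\<in>T. sieve_density s p)"
    if T: "T \<in> D" for T
  proof -
    define Q where "Q = {y \<in> A \<times> B. rd y = T}"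
    define E where "E = (\<lambda>p. {(i, j) \<in> {..w} \<times> {..w}. (i, j) \<noteq> (0, 0) \<and> (p dvd s \<longrightarrow> j = 0)})"
    define f :: "nat \<times> nat \<Rightarrow> nat \<Rightarrow> nat \<times> nat"
      where "f = (\<lambda>(a, b). restrict (\<lambda>p. (multiplicity p a, multiplicity p b)) T)"
    define H where "H = (\<lambda>p (i, j). (1 / real p) ^ i * (1 / real p) ^ j)"
    have TP: "finite T" "T \<subseteq> P" using T finP by (auto simp: D_def intro: finite_subset)
    have T_prime: "prime p" "p \<ge> 3" if "p \<in> T" for p
    proof -
      have p: "prime p" "odd p" using that TP(2) by (auto simp: P_def)
      show "prime p" by fact
      have "p \<noteq> 2" using p(2) by auto
      thus "p \<ge> 3" using prime_ge_2_nat[OF p(1)] by linarith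
    qed
    have Q: "a > 0" "b > 0" "a \<le> w" "b \<le> w" "coprime b s"
        "(\<Prod>p\<in>T. p ^ multiplicity p a) = a" "(\<Prod>p\<in>T. p ^ multiplicity p b) = b"
        "prime_factors (a * b) = T"
      if "(a, b) \<in> Q" for a b
    proof -
      show ab: "a > 0" "b > 0" "a \<le> w" "b \<le> w" "coprime b s" "prime_factors (a * b) = T"
        using that by (auto simp: Q_def A_def B_def rd_def)
      have "prime_factors a \<subseteq> T" "prime_factors b \<subseteq> T"
        using ab(6) prime_factors_product[of a b] ab(1,2) by auto
      thus "(\<Prod>p\<in>T. p ^ multiplicity p a) = a" "(\<Prod>p\<in>T. p ^ multiplicity p b) = b"
        using ab TP T_prime by (auto intro!: prod_multiplicity_superset)
    qed
    have mult_le: "multiplicity p a \<le> w" if "p \<in> T" "a > 0" "a \<le> w" for p a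
    proof -
      have "multiplicity p a < p ^ multiplicity p a"
        using T_prime(2)[OF that(1)] by (intro less_exp[THEN less_le_trans] power_mono) auto
      also have "\<dots> \<le> a" using that(2) by (intro dvd_imp_le multiplicity_dvd)
      finally show ?thesis using that(3) by simp
    qed
    have f_E: "f y \<in> PiE T E" if "y \<in> Q" for y
    proof -
      obtain a b where y: "y = (a, b)" by (cases y)
      note ab = Q[OF that[unfolded y]]
      \<comment> \<open>As \<open>p\<close> divides \<open>a * b\<close>, the exponents are not both
        0; if \<open>p\<close> divides \<open>s\<close>, coprimality keeps it out of
        \<open>b\<close>.\<close>
      have "(multiplicity p a, multiplicity p b) \<in> E p" if p: "p \<in> T" for p
      proof -
        have "p dvd a * b" using p ab(8) by auto
        hence "p dvd a \<or> p dvd b" using T_prime(1)[OF p] by (simp add: prime_dvd_mult_iff)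
        hence "multiplicity p a \<noteq> 0 \<or> multiplicity p b \<noteq> 0"
          using ab T_prime(1)[OF p] by (auto simp: multiplicity_eq_zero_iff prime_nat_iff)
        moreover have "multiplicity p b = 0" if "p dvd s"
        proof -
          have "\<not> p dvd b" using ab(5) that T_prime(1)[OF p]
            by (meson coprime_common_divisor not_prime_unit)
          thus ?thesis by (rule not_dvd_imp_multiplicity_0)
        qed
        ultimately show ?thesis
          using mult_le[OF p] ab unfolding E_def by auto
      qed
      thus ?thesis unfolding y f_def by auto
    qed
    have inj: "inj_on f Q"
    proof (rule inj_onI)
      fix y y' assume yy: "y \<in> Q" "y' \<in> Q" "f y = f y'"
      obtain a b a' b' where y: "y = (a, b)" "y' = (a', b')" by (cases y, cases y')
      have "multiplicity p a = multiplicity p a' \<and> multiplicity p b = multiplicity p b'" if "p \<in> T" for p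
        using fun_cong[OF yy(3), of p] that by (simp add: f_def y)
      hence "(\<Prod>p\<in>T. p ^ multiplicity p a) = (\<Prod>p\<in>T. p ^ multiplicity p a')"
          "(\<Prod>p\<in>T. p ^ multiplicity p b) = (\<Prod>p\<in>T. p ^ multiplicity p b')"
        by (auto intro!: prod.cong)
      thus "y = y'"
        using Q(6,7)[of a b] Q(6,7)[of a' b'] yy(1,2) unfolding y by simp
    qed
    have val: "(case y of (a, b) \<Rightarrow> 1 / real a * (1 / real b)) = (\<Prod>p\<in>T. H p (f y p))" if "y \<in> Q" for y
    proof -
      obtain a b where y: "y = (a, b)" by (cases y)
      note ab = Q[OF that[unfolded y]]
      have "(\<Prod>p\<in>T. H p (f y p)) = (\<Prod>p\<in>T. 1 / real (p ^ multiplicity p a)) * (\<Prod>p\<in>T. 1 / real (p ^ multiplicity p b))"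
        unfolding prod.distrib[symmetric] by (intro prod.cong) (auto simp: H_def f_def y power_one_over)
      also have "\<dots> = 1 / real a * (1 / real b)"
        unfolding prod_dividef of_nat_prod[symmetric] ab(6,7) by simp
      finally show ?thesis unfolding y by simp
    qed
    have finE: "finite (E p)" for p
      unfolding E_def by (rule finite_subset[of _ "{..w} \<times> {..w}"]) auto
    have "(\<Sum>(a, b)\<in>Q. 1 / real a * (1 / real b)) = (\<Sum>y\<in>Q. \<Prod>p\<in>T. H p (f y p))"
      by (intro sum.cong refl val)
    also have "\<dots> = (\<Sum>h\<in>f ` Q. \<Prod>p\<in>T. H p (h p))"
      by (subst sum.reindex[OF inj]) simp
    \<comment> \<open>Enlarging the image of \<open>f\<close> to the full product of index sets adds
      only nonnegative terms and lets the sum factor over \<open>T\<close>.\<close>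
    also have "\<dots> \<le> (\<Sum>h\<in>PiE T E. \<Prod>p\<in>T. H p (h p))"
      using f_E TP(1) finE by (intro sum_mono2 finite_PiE) (auto intro!: prod_nonneg simp: H_def case_prod_unfold)
    also have "\<dots> = (\<Prod>p\<in>T. \<Sum>y\<in>E p. H p y)"
      using TP(1) finE by (intro prod_sum_PiE[symmetric]) auto
    also have "\<dots> \<le> (\<Prod>p\<in>T. sieve_density s p)"
    proof (intro prod_mono conjI)
      fix p assume p: "p \<in> T"
      show "0 \<le> (\<Sum>y\<in>E p. H p y)"
        by (intro sum_nonneg) (auto simp: H_def)
      show "(\<Sum>y\<in>E p. H p y) \<le> sieve_density s p"
        using sieve_density_ge[OF T_prime(2)[OF p], of w s] by (simp add: H_def E_def)
    qed
    also have "Q = {(a, b). (a, b) \<in> A \<times> B \<and> rd (a, b) = T}"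
      by (auto simp: Q_def)
    finally show ?thesis .
  qed
  have "(\<Sum>a\<in>A. 1 / real a) * (\<Sum>b\<in>B. 1 / real b) = (\<Sum>(a, b)\<in>A \<times> B. 1 / real a * (1 / real b))"
    by (simp only: sum_product sum.cartesian_product)
  also have "\<dots> = (\<Sum>T\<in>D. \<Sum>(a, b)\<in>{y \<in> A \<times> B. rd y = T}. 1 / real a * (1 / real b))"
    using rd_D finA finB finD by (intro sum.group[symmetric]) auto
  also have "\<dots> \<le> (\<Sum>T\<in>D. \<Prod>p\<in>T. sieve_density s p)"
  proof (rule sum_mono)
    fix T assume T: "T \<in> D"
    have "{y \<in> A \<times> B. rd y = T} = {(a, b). (a, b) \<in> A \<times> B \<and> rd (a, b) = T}" by auto
    thus "(\<Sum>(a, b)\<in>{y \<in> A \<times> B. rd y = T}. 1 / real a * (1 / real b)) \<le> (\<Prod>p\<in>T. sieve_density s p)"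
      using fiber[OF T] by simp
  qed
  finally show ?thesis .
qed

text \<open>Odd \<open>a\<close> are those coprime to 2, and
  \<open>inv_divisor_sum 2 = 3 / 2\<close> gives the factor \<open>harm w / 3\<close>. For even
  \<open>s > 0\<close> coprimality to \<open>s\<close> already forces \<open>b\<close> odd, which
  gives a second factor \<open>harm w / (2 * inv_divisor_sum s)\<close>.\<close>

lemma sieve_density_sum_lower:
  fixes s w :: nat
  assumes w: "w \<ge> 1" and s: "even s"
  defines "P \<equiv> {p. prime p \<and> odd p \<and> p \<le> w * w}"
  defines "D \<equiv> {T. T \<subseteq> P \<and> \<Prod>T \<le> w * w}"
  defines "G \<equiv> \<Sum>T\<in>D. \<Prod>p\<in>T. sieve_density s p"
  shows "s = 0 \<Longrightarrow> G \<ge> harm w / 3"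
    and "s > 0 \<Longrightarrow> G \<ge> (harm w)\<^sup>2 / (6 * inv_divisor_sum s)"
proof -
  define A where "A = {a \<in> {1..w}. odd a}"
  define B where "B = {b \<in> {1..w}. odd b \<and> coprime b s}"
  have G: "(\<Sum>a\<in>A. 1 / real a) * (\<Sum>b\<in>B. 1 / real b) \<le> G"
    unfolding G_def D_def P_def A_def B_def by (rule sieve_density_sum_ge)
  have "{d::nat. d dvd 2} = {1, 2}"
    using dvd_imp_le[of _ "2::nat"] by (force simp: le_Suc_eq numeral_2_eq_2)
  hence I: "inv_divisor_sum 2 = 3 / 2"
    unfolding inv_divisor_sum_def by simp
  have "{b. b \<in> {1..w} \<and> coprime b 2} = A" by (auto simp: A_def)
  hence A: "(\<Sum>a\<in>A. 1 / real a) \<ge> harm w / 3"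
    using harm_le_coprime_sum[of 2 w] unfolding I by simp
  have A0: "(\<Sum>a\<in>A. 1 / real a) \<ge> 0" by (intro sum_nonneg) auto
  show "G \<ge> harm w / 3" if "s = 0"
  proof -
    \<comment> \<open>Only 1 is coprime to 0, so a single logarithm is gained.\<close>
    have "B = {1}" using that w by (auto simp: B_def)
    thus ?thesis using G A by simp
  qed
  show "G \<ge> (harm w)\<^sup>2 / (6 * inv_divisor_sum s)" if "s > 0"
  proof -
    have "B = {b. b \<in> {1..w} \<and> coprime b s}"
      using s by (auto simp: B_def dest: coprime_common_divisor)
    hence B: "harm w \<le> 2 * (\<Sum>b\<in>B. 1 / real b) * inv_divisor_sum s"
      using harm_le_coprime_sum[OF that, of w] by simp
    have pos: "inv_divisor_sum s > 0" using inv_divisor_sum_ge_1[OF that] by simp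
    have "(harm w)\<^sup>2 / (6 * inv_divisor_sum s) = harm w / 3 * (harm w / (2 * inv_divisor_sum s))"
      by (simp add: power2_eq_square)
    also have "\<dots> \<le> (\<Sum>a\<in>A. 1 / real a) * (\<Sum>b\<in>B. 1 / real b)"
      using A B pos by (intro mult_mono A0) (auto simp: field_simps harm_nonneg)
    finally show ?thesis using G by simp
  qed
qed

subsection \<open>Prime pairs at a fixed distance\<close>

lemma unique_root_linear_mod:
  fixes p :: nat and c :: int
  assumes p: "prime p" "odd p"
  shows "\<exists>j<p. {i \<in> {..<p}. int p dvd 2 * int i + c} = {j}"
proof -
  obtain h where h: "p = 2 * h + 1" using p(2) by (elim oddE)
  \<comment> \<open>With \<open>p = 2 * h + 1\<close>, \<open>2 * h\<close> is congruent to -1, so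
    \<open>c * h\<close> is a root of \<open>2 * i + c\<close>.\<close>
  define j where "j = nat ((c * int h) mod int p)"
  have p0: "p > 0" using prime_gt_0_nat p(1) by blast
  have j: "int j = (c * int h) mod int p" using p0 by (simp add: j_def)
  have "[2 * int j + c = 2 * (c * int h) + c] (mod int p)"
    unfolding j by (intro cong_add cong_mult cong_refl) (simp add: cong_def)
  also have "2 * (c * int h) + c = int p * c" by (simp add: h algebra_simps)
  finally have root: "int p dvd 2 * int j + c"
    by (simp add: cong_0_iff cong_def dvd_eq_mod_eq_0)
  have j_less: "j < p"
  proof -
    have "int j < int p" unfolding j using p0 by (intro pos_mod_bound) auto
    thus ?thesis by simp
  qed
  have uniq: "i = j" if "i < p" "int p dvd 2 * int i + c" for i
  proof -
    have "int p dvd (2 * int i + c) - (2 * int j + c)"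
      using that(2) root by (rule dvd_diff)
    hence "int p dvd 2 * (int i - int j)" by (simp add: algebra_simps)
    moreover have "coprime (int p) 2" using p(2) by simp
    ultimately have "int p dvd int i - int j" using coprime_dvd_mult_right_iff by blast
    hence "[i = j] (mod p)" by (simp add: cong_iff_dvd_diff flip: cong_int_iff)
    thus "i = j" using that(1) j_less by (simp add: cong_def)
  qed
  have "{i \<in> {..<p}. int p dvd 2 * int i + c} = {j}"
  proof (intro equalityI subsetI)
    fix i assume "i \<in> {i \<in> {..<p}. int p dvd 2 * int i + c}"
    thus "i \<in> {j}" using uniq[of i] by blast
  qed (use root j_less in simp)
  thus ?thesis using j_less by blast
qed

lemma card_prime_pair_roots:
  fixes p :: nat and c s :: int
  assumes p: "prime p" "odd p"
  shows "card {i \<in> {..<p}. int p dvd 2 * int i + c \<or> int p dvd 2 * int i + c + s}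
          = (if p dvd nat \<bar>s\<bar> then 1 else 2)"
proof -
  obtain j where j: "{i \<in> {..<p}. int p dvd 2 * int i + c} = {j}"
    using unique_root_linear_mod[OF p, of c] by blast
  obtain k where k: "{i \<in> {..<p}. int p dvd 2 * int i + (c + s)} = {k}"
    using unique_root_linear_mod[OF p, of "c + s"] by blast
  have "{i \<in> {..<p}. int p dvd 2 * int i + c \<or> int p dvd 2 * int i + c + s}
      = {i \<in> {..<p}. int p dvd 2 * int i + c} \<union> {i \<in> {..<p}. int p dvd 2 * int i + (c + s)}"
    by (auto simp: add.assoc)
  hence eq: "{i \<in> {..<p}. int p dvd 2 * int i + c \<or> int p dvd 2 * int i + c + s} = {j, k}"
    unfolding j k by auto
  have jd: "int p dvd 2 * int j + c" "j < p" using j by auto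
  have kd: "int p dvd 2 * int k + (c + s)" "k < p" using k by auto
  have "j = k \<longleftrightarrow> int p dvd s"
  proof
    assume "j = k"
    hence "int p dvd (2 * int k + (c + s)) - (2 * int j + c)"
      using jd(1) kd(1) by (intro dvd_diff)
    thus "int p dvd s" using \<open>j = k\<close> by simp
  next
    assume "int p dvd s"
    hence "int p dvd 2 * int j + (c + s)"
      using dvd_add[OF jd(1), of s] by (simp add: add.assoc)
    thus "j = k" using jd(2) k by auto
  qed
  moreover have "int p dvd s \<longleftrightarrow> p dvd nat \<bar>s\<bar>"
    by (metis dvd_abs_iff int_dvd_int_iff int_nat_eq abs_ge_zero)
  ultimately have jk: "j = k \<longleftrightarrow> p dvd nat \<bar>s\<bar>" by blast
  show ?thesis
  proof (cases "j = k")
    case True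
    thus ?thesis unfolding eq jk[symmetric] by simp
  next
    case False
    thus ?thesis unfolding eq jk[symmetric] by simp
  qed
qed

text \<open>The probability that \<open>R_n\<close> and \<open>R_n + s\<close> are both prime, for a
  fixed increment \<open>s\<close>.\<close>

definition prime_pair_prob :: "nat \<Rightarrow> int \<Rightarrow> real" where
  "prime_pair_prob n s = (\<Sum>j\<le>n. half_binom n j *
     of_bool (abs_prime (2 * int j - int n) \<and> abs_prime (2 * int j - int n + s)))"

text \<open>Used for values that may themselves be sieving primes: \<open>2 * j + c\<close> is
  injective in \<open>j\<close>, so at most \<open>2 * z + 1\<close> weights occur.\<close>

lemma half_binom_window:
  fixes c :: int and z :: nat
  shows "(\<Sum>j\<le>n. half_binom n j * of_bool (\<bar>2 * int j + c\<bar> \<le> int z))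
          \<le> (2 * real z + 1) * (2 / sqrt (real (Suc n)))"
proof -
  define J where "J = {j \<in> {..n}. \<bar>2 * int j + c\<bar> \<le> int z}"
  have "card J \<le> card {- int z..int z}"
    by (rule card_inj_on_le[where f = "\<lambda>j. 2 * int j + c"]) (auto simp: J_def inj_on_def)
  hence J: "real (card J) \<le> 2 * real z + 1" by simp
  have "(\<Sum>j\<le>n. half_binom n j * of_bool (\<bar>2 * int j + c\<bar> \<le> int z)) = (\<Sum>j\<in>J. half_binom n j)"
    by (rule sum.mono_neutral_cong_right) (auto simp: J_def)
  also have "\<dots> \<le> (\<Sum>j\<in>J. 2 / sqrt (real (Suc n)))"
    by (intro sum_mono half_binom_le)
  also have "\<dots> \<le> (2 * real z + 1) * (2 / sqrt (real (Suc n)))"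
    using J by (simp only: sum_constant) (intro mult_right_mono, auto)
  finally show ?thesis .
qed

text \<open>A prime pair survives the sieve unless one of its members is, up to sign, a sieving
  prime and so at most \<open>w * w\<close> in absolute value. The Selberg bound with level
  \<open>w * w\<close> handles the first case, two windows the second.\<close>

lemma prime_pair_prob_sieve:
  fixes n w :: nat and s :: int
  defines "P \<equiv> {p. prime p \<and> odd p \<and> p \<le> w * w}"
  defines "D \<equiv> {T. T \<subseteq> P \<and> \<Prod>T \<le> w * w}"
  assumes w: "w \<ge> 1"
  shows "prime_pair_prob n s \<le> 1 / (\<Sum>T\<in>D. \<Prod>p\<in>T. sieve_density (nat \<bar>s\<bar>) p)
           + 14 * (real w ^ 12 / sqrt (real (Suc n)))"
proof -
  define V where "V = 2 / sqrt (real (Suc n))"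
  define \<Omega> where "\<Omega> = (\<lambda>p j. int p dvd 2 * int j - int n \<or> int p dvd 2 * int j - int n + s)"
  define \<rho> where "\<rho> = (\<lambda>p. card {j \<in> {..<p}. \<Omega> p j})"
  have V: "V \<ge> 0" by (simp add: V_def)
  have finP: "finite P" unfolding P_def by (rule finite_subset[of _ "{..w*w}"]) auto
  have \<rho>: "\<rho> p = (if p dvd nat \<bar>s\<bar> then 1 else 2)" if "p \<in> P" for p
    using card_prime_pair_roots[of p "- int n" s] that by (simp add: \<rho>_def \<Omega>_def P_def)
  have p3: "p \<ge> 3" if "p \<in> P" for p
  proof -
    have p: "prime p" "odd p" using that by (auto simp: P_def)
    have "p \<noteq> 2" using p(2) by auto
    thus "p \<ge> 3" using prime_ge_2_nat[OF p(1)] by linarith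
  qed
  have per: "\<Omega> p j = \<Omega> p (j mod p)" for p j
  proof -
    have "int p dvd 2 * int j + c \<longleftrightarrow> int p dvd 2 * int (j mod p) + c" for c
    proof -
      have "[2 * int j + c = 2 * int (j mod p) + c] (mod int p)"
        by (intro cong_add cong_mult cong_refl) (simp add: cong_def of_nat_mod)
      thus ?thesis by (simp add: cong_def dvd_eq_mod_eq_0)
    qed
    from this[of "- int n"] this[of "- int n + s"] show ?thesis
      by (simp add: \<Omega>_def algebra_simps)
  qed
  have dens: "real (\<rho> p) / (real p - real (\<rho> p)) = sieve_density (nat \<bar>s\<bar>) p" if "p \<in> P" for p
    unfolding \<rho>[OF that] sieve_density_def by simp
  have "(\<Sum>j\<le>n. half_binom n j * of_bool (\<forall>p\<in>P. \<not> \<Omega> p j))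
     \<le> 1 / (\<Sum>T\<in>D. \<Prod>p\<in>T. real (\<rho> p) / (real p - real (\<rho> p))) + real (w * w) ^ 6 * V"
    unfolding \<rho>_def V_def
  proof (rule selberg_sieve)
    show "card {j \<in> {..<p}. \<Omega> p j} < p" if "p \<in> P" for p
      using \<rho>[OF that] p3[OF that] by (simp add: \<rho>_def)
  qed (use finP per w in \<open>auto simp: P_def D_def\<close>)
  also have "(\<Sum>T\<in>D. \<Prod>p\<in>T. real (\<rho> p) / (real p - real (\<rho> p)))
      = (\<Sum>T\<in>D. \<Prod>p\<in>T. sieve_density (nat \<bar>s\<bar>) p)"
    using dens by (intro sum.cong prod.cong refl) (auto simp: D_def)
  finally have main: "(\<Sum>j\<le>n. half_binom n j * of_bool (\<forall>p\<in>P. \<not> \<Omega> p j))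
     \<le> 1 / (\<Sum>T\<in>D. \<Prod>p\<in>T. sieve_density (nat \<bar>s\<bar>) p) + real (w * w) ^ 6 * V" .
  have small: "\<bar>x\<bar> \<le> int (w * w)" if "abs_prime x" "p \<in> P" "int p dvd x" for x p
  proof -
    have "prime (nat \<bar>x\<bar>)" using that(1) unfolding abs_prime_def by (subst (asm) prime_int_nat_transfer) blast
    moreover have "p dvd nat \<bar>x\<bar>"
      using that(3) by (metis dvd_abs_iff int_dvd_int_iff int_nat_eq abs_ge_zero)
    moreover have "prime p" using that(2) by (simp add: P_def)
    ultimately have "p = nat \<bar>x\<bar>" by (simp add: primes_dvd_imp_eq)
    hence "nat \<bar>x\<bar> \<le> w * w" using that(2) unfolding P_def by simp
    thus ?thesis unfolding nat_le_iff .
  qed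
  have "prime_pair_prob n s \<le> (\<Sum>j\<le>n. half_binom n j * (of_bool (\<forall>p\<in>P. \<not> \<Omega> p j)
      + of_bool (\<bar>2 * int j + (- int n)\<bar> \<le> int (w * w)) + of_bool (\<bar>2 * int j + (- int n + s)\<bar> \<le> int (w * w))))"
    unfolding prime_pair_prob_def
  proof (intro sum_mono mult_left_mono half_binom_nonneg)
    fix j
    show "of_bool (abs_prime (2 * int j - int n) \<and> abs_prime (2 * int j - int n + s))
      \<le> (of_bool (\<forall>p\<in>P. \<not> \<Omega> p j) + of_bool (\<bar>2 * int j + (- int n)\<bar> \<le> int (w * w))
         + of_bool (\<bar>2 * int j + (- int n + s)\<bar> \<le> int (w * w)) :: real)"
    proof (cases "abs_prime (2 * int j - int n) \<and> abs_prime (2 * int j - int n + s) \<and> (\<exists>p\<in>P. \<Omega> p j)")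
      case True
      hence "\<bar>2 * int j - int n\<bar> \<le> int (w * w) \<or> \<bar>2 * int j - int n + s\<bar> \<le> int (w * w)"
        using small unfolding \<Omega>_def by blast
      hence "\<bar>2 * int j + (- int n)\<bar> \<le> int (w * w) \<or> \<bar>2 * int j + (- int n + s)\<bar> \<le> int (w * w)"
        by (simp add: algebra_simps)
      thus ?thesis by (auto simp del: of_nat_mult)
    next
      case False
      thus ?thesis by (auto simp del: of_nat_mult)
    qed
  qed
  also have "\<dots> \<le> (1 / (\<Sum>T\<in>D. \<Prod>p\<in>T. sieve_density (nat \<bar>s\<bar>) p) + real (w * w) ^ 6 * V)
      + (2 * real (w * w) + 1) * V + (2 * real (w * w) + 1) * V"
    unfolding distrib_left sum.distrib V_def
    by (intro add_mono main[unfolded V_def] half_binom_window)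
  also have "\<dots> = 1 / (\<Sum>T\<in>D. \<Prod>p\<in>T. sieve_density (nat \<bar>s\<bar>) p) + (real w ^ 12 + 4 * real w ^ 2 + 2) * V"
    by (simp add: algebra_simps power_mult_distrib power_add[symmetric] power2_eq_square)
  \<comment> \<open>The coefficients add up to 7; the numerator 2 of \<open>V\<close> makes this
    14.\<close>
  also have "(real w ^ 12 + 4 * real w ^ 2 + 2) * V \<le> (7 * real w ^ 12) * V"
  proof (intro mult_right_mono V)
    have "real w ^ 2 \<le> real w ^ 12" "1 \<le> real w ^ 12"
      using w by (auto intro: power_increasing)
    thus "real w ^ 12 + 4 * real w ^ 2 + 2 \<le> 7 * real w ^ 12" by linarith
  qed
  finally show ?thesis by (simp add: V_def)
qed

lemma nat_root_floor:
  fixes n k :: nat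
  assumes "n \<ge> 1" "k \<ge> 1"
  shows "\<exists>w\<ge>1. w ^ k \<le> n \<and> n < (w + 1) ^ k"
proof -
  define w where "w = Max {w. w ^ k \<le> n}"
  have bd: "w \<le> n" if "w ^ k \<le> n" for w
    using that assms(2) self_le_power[of w k] by (cases "w = 0") (auto intro: order_trans)
  have fin: "finite {w. w ^ k \<le> n}"
    by (rule finite_subset[of _ "{..n}"]) (use bd in auto)
  have one: "1 \<in> {w. w ^ k \<le> n}" using assms by simp
  have "w \<in> {w. w ^ k \<le> n}" unfolding w_def using fin one Max_in by blast
  moreover have "w \<ge> 1" unfolding w_def using fin one by (intro Max_ge) auto
  moreover have "\<not> (w + 1) ^ k \<le> n"
  proof
    assume "(w + 1) ^ k \<le> n"
    hence "w + 1 \<le> Max {w. w ^ k \<le> n}" using fin by (intro Max_ge) auto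
    thus False by (simp add: w_def[symmetric])
  qed
  ultimately show ?thesis by (auto simp: not_le)
qed

lemma ln_ge_1: "n \<ge> 3 \<Longrightarrow> ln (real n) \<ge> 1"
  using exp_le by (subst ln_ge_iff) auto

lemma prime_pair_prob_le:
  fixes n :: nat and s :: int
  assumes n: "n \<ge> 3" and s: "even s"
  shows "s = 0 \<Longrightarrow> prime_pair_prob n s \<le> 1040 / ln (real n)"
    and "s \<noteq> 0 \<Longrightarrow> prime_pair_prob n s \<le> 14720 * inv_divisor_sum (nat \<bar>s\<bar>) / (ln (real n))\<^sup>2"
proof -
  define L where "L = ln (real n)"
  have L: "L \<ge> 1" using ln_ge_1[OF n] by (simp add: L_def)
  \<comment> \<open>The exponent 48 makes \<open>w ^ 12\<close> at most the fourth root of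
    \<open>n\<close>, well below \<open>sqrt n\<close>, while \<open>harm w\<close> keeps the order
    of \<open>ln n\<close>.\<close>
  obtain w where w: "w \<ge> 1" "w ^ 48 \<le> n" "n < (w + 1) ^ 48"
    using nat_root_floor[of n 48] n by auto
  define G where "G = (\<Sum>T | T \<subseteq> {p. prime p \<and> odd p \<and> p \<le> w * w} \<and> \<Prod>T \<le> w * w.
     \<Prod>p\<in>T. sieve_density (nat \<bar>s\<bar>) p)"
  have "L \<le> ln (real ((w + 1) ^ 48))"
    unfolding L_def using w(3) n by (subst ln_le_cancel_iff) (auto simp del: of_nat_power)
  also have "\<dots> = 48 * ln (real w + 1)" using w(1) by (simp add: ln_realpow add.commute)
  also have "\<dots> \<le> 48 * harm w" using ln_le_harm[of w] by simp
  finally have H: "harm w \<ge> L / 48" by simp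
  have err: "14 * (real w ^ 12 / sqrt (real (Suc n))) \<le> 896 / L\<^sup>2"
  proof -
    \<comment> \<open>In terms of the eighth root \<open>r\<close>, the error is at most
      \<open>r^2 / r^4\<close>; \<open>L = 8 * ln r \<le> 8 * r\<close> turns this into
      \<open>64 / L^2\<close>, and \<open>14 * 64 = 896\<close>.\<close>
    define r where "r = root 8 (real n)"
    have r: "r > 0" "r ^ 8 = real n" using n by (auto simp: r_def)
    have "(real w ^ 12) ^ 4 = real (w ^ 48)" by (simp add: power_mult[symmetric])
    also have "\<dots> \<le> real n" using w(2) by (simp only: of_nat_le_iff)
    also have "real n = (r ^ 2) ^ 4" using r by (simp add: power_mult[symmetric])
    finally have wr: "real w ^ 12 \<le> r ^ 2" by (rule power_le_imp_le_base[where n = 3, simplified]) (use r in auto)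
    have "r ^ 4 \<le> sqrt (real (Suc n))"
      using r by (intro real_le_rsqrt) (simp add: power_mult[symmetric])
    hence "real w ^ 12 / sqrt (real (Suc n)) \<le> r ^ 2 / r ^ 4"
      using wr r by (intro frac_le) auto
    also have "\<dots> = 1 / r ^ 2" using r(1) by (simp add: field_simps power2_eq_square power_numeral_reduce)
    finally have 1: "real w ^ 12 / sqrt (real (Suc n)) \<le> 1 / r\<^sup>2" .
    have "L = 8 * ln r" unfolding L_def r(2)[symmetric] using r(1) by (simp add: ln_realpow)
    also have "\<dots> \<le> 8 * r" using ln_less_self[OF r(1)] by simp
    finally have "L\<^sup>2 \<le> (8 * r)\<^sup>2" using L by (intro power_mono) auto
    hence "L\<^sup>2 \<le> 64 * r\<^sup>2" by (simp add: power_mult_distrib)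
    hence "1 / r\<^sup>2 \<le> 64 / L\<^sup>2" using r(1) L by (simp add: field_simps)
    thus ?thesis using 1 by simp
  qed
  have E: "prime_pair_prob n s \<le> 1 / G + 896 / L\<^sup>2"
    using prime_pair_prob_sieve[OF w(1), of n s] err unfolding G_def by linarith
  show "prime_pair_prob n s \<le> 1040 / ln (real n)" if "s = 0"
  proof -
    have "G \<ge> harm w / 3"
      unfolding G_def using w(1) s that by (intro sieve_density_sum_lower) auto
    \<comment> \<open>Here \<open>144 = 3 * 48\<close>, and \<open>1040 = 144 + 896\<close> because
      \<open>L \<ge> 1\<close> weakens the error to \<open>896 / L\<close>.\<close>
    hence "G \<ge> L / 144" using H by simp
    hence "1 / G \<le> 1 / (L / 144)" using L by (intro divide_left_mono) auto
    moreover have "896 / L\<^sup>2 \<le> 896 / L" using L by (intro divide_left_mono) (auto simp: power2_eq_square)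
    ultimately have "prime_pair_prob n s \<le> 144 / L + 896 / L" using E by simp
    thus ?thesis by (simp add: L_def add_divide_distrib[symmetric])
  qed
  show "prime_pair_prob n s \<le> 14720 * inv_divisor_sum (nat \<bar>s\<bar>) / (ln (real n))\<^sup>2" if "s \<noteq> 0"
  proof -
    define \<sigma> where "\<sigma> = inv_divisor_sum (nat \<bar>s\<bar>)"
    have \<sigma>: "\<sigma> \<ge> 1" using that by (simp add: \<sigma>_def inv_divisor_sum_ge_1)
    have ev: "even (nat \<bar>s\<bar>)" using s by (simp add: even_nat_iff)
    have "G \<ge> (harm w)\<^sup>2 / (6 * \<sigma>)"
      unfolding G_def \<sigma>_def using w(1) ev that by (intro sieve_density_sum_lower) auto
    moreover have "(harm w)\<^sup>2 / (6 * \<sigma>) \<ge> (L / 48)\<^sup>2 / (6 * \<sigma>)"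
      using H L \<sigma> by (intro divide_right_mono power_mono) auto
    ultimately have "G \<ge> (L / 48)\<^sup>2 / (6 * \<sigma>)" by linarith
    moreover have "(L / 48)\<^sup>2 / (6 * \<sigma>) > 0" using L \<sigma> by simp
    ultimately have "1 / G \<le> 1 / ((L / 48)\<^sup>2 / (6 * \<sigma>))" by (intro divide_left_mono mult_pos_pos) auto
    \<comment> \<open>Here \<open>13824 = 6 * 48^2\<close>; since \<open>\<sigma> \<ge> 1\<close>,
      the error 896 is absorbed to give 14720.\<close>
    also have "\<dots> = 13824 * \<sigma> / L\<^sup>2" using L \<sigma> by (simp add: power2_eq_square)
    finally have "prime_pair_prob n s \<le> 13824 * \<sigma> / L\<^sup>2 + 896 / L\<^sup>2" using E by simp
    also have "\<dots> \<le> 13824 * \<sigma> / L\<^sup>2 + 896 * \<sigma> / L\<^sup>2"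
      using \<sigma> by (intro add_left_mono divide_right_mono) auto
    finally show ?thesis by (simp add: L_def \<sigma>_def add_divide_distrib[symmetric])
  qed
qed

subsection \<open>Averaging over the distance\<close>

lemma half_binom_symmetric: "k \<le> n \<Longrightarrow> half_binom n (n - k) = half_binom n k"
  by (simp add: half_binom_def binomial_symmetric[symmetric])

lemma half_binom_antimono:
  "k \<le> k' \<Longrightarrow> n div 2 \<le> k \<Longrightarrow> half_binom n k' \<le> half_binom n k"
proof (cases "k' \<le> n")
  case True
  moreover assume "k \<le> k'" "n div 2 \<le> k"
  ultimately show ?thesis
    using binomial_antimono[of k k' n] unfolding half_binom_def by (intro divide_right_mono) auto
qed simp

text \<open>Each weight at a multiple of \<open>d\<close> is dominated by the roughly \<open>d / 2\<close> weights preceding it, and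
  these blocks are disjoint.\<close>

lemma half_binom_multiples_le:
  fixes M d :: nat
  assumes d: "d \<ge> 1"
  shows "(\<Sum>i | i \<in> {1..M} \<and> d dvd 2 * i. half_binom (2 * M) (M + i)) \<le> 2 / real d"
proof -
  define I where "I = {i \<in> {1..M}. d dvd 2 * i}"
  define R where "R = {t. 2 * t < d}"
  have finR: "finite R" unfolding R_def by (rule finite_subset[of _ "{..<d}"]) auto
  have "{..<(d + 1) div 2} \<subseteq> R" by (auto simp: R_def)
  hence "card {..<(d + 1) div 2} \<le> card R" by (intro card_mono finR)
  hence "(d + 1) div 2 \<le> card R" by simp
  hence "d \<le> 2 * card R" by linarith
  hence R: "real d / 2 \<le> real (card R)" by linarith
  \<comment> \<open>The blocks stay strictly to the right of the centre \<open>M\<close>, where the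
    weights decrease.\<close>
  have ti: "t < i" if "i \<in> I" "t \<in> R" for i t
  proof -
    have "d \<le> 2 * i" using that(1) by (intro dvd_imp_le) (auto simp: I_def)
    thus ?thesis using that(2) by (simp add: R_def)
  qed
  \<comment> \<open>Blocks are disjoint: a collision would give two multiples \<open>2 * i\<close>
    and \<open>2 * i'\<close> of \<open>d\<close> at distance
    \<open>2 * \<bar>t - t'\<bar> < d\<close>.\<close>
  have inj: "inj_on (\<lambda>(i, t). M + i - t) (I \<times> R)"
  proof (rule inj_onI, clarify)
    fix i t i' t'
    assume a: "i \<in> I" "t \<in> R" "i' \<in> I" "t' \<in> R" "M + i - t = M + i' - t'"
    have eq: "int i - int i' = int t - int t'"
      using a(5) ti[OF a(1,2)] ti[OF a(3,4)] by linarith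
    have "int d dvd int (2 * i) - int (2 * i')"
      using a(1,3) by (intro dvd_diff) (auto simp: I_def simp del: of_nat_mult)
    moreover have "\<bar>int (2 * i) - int (2 * i')\<bar> < int d"
      using eq a(2,4) by (auto simp: R_def)
    ultimately have "int (2 * i) - int (2 * i') = 0"
      using dvd_imp_le_int[of "int (2 * i) - int (2 * i')" "int d"] by fastforce
    thus "i = i' \<and> t = t'" using eq by simp
  qed
  have "real (card R) * (\<Sum>i\<in>I. half_binom (2 * M) (M + i)) = (\<Sum>i\<in>I. \<Sum>t\<in>R. half_binom (2 * M) (M + i))"
    by (simp add: sum_distrib_left)
  also have "\<dots> \<le> (\<Sum>i\<in>I. \<Sum>t\<in>R. half_binom (2 * M) (M + i - t))"
  proof (intro sum_mono half_binom_antimono)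
    fix i t assume "i \<in> I" "t \<in> R"
    thus "2 * M div 2 \<le> M + i - t" using ti[of i t] by simp
  qed auto
  also have "\<dots> = (\<Sum>y\<in>I \<times> R. half_binom (2 * M) ((\<lambda>(i, t). M + i - t) y))"
    by (simp add: sum.cartesian_product case_prod_unfold)
  also have "\<dots> = (\<Sum>k\<in>(\<lambda>(i, t). M + i - t) ` (I \<times> R). half_binom (2 * M) k)"
    by (subst sum.reindex[OF inj]) simp
  also have "\<dots> \<le> (\<Sum>k\<le>2 * M. half_binom (2 * M) k)"
    by (intro sum_mono2) (auto simp: I_def)
  finally have "real (card R) * (\<Sum>i\<in>I. half_binom (2 * M) (M + i)) \<le> 1" by simp
  moreover have "real d / 2 * (\<Sum>i\<in>I. half_binom (2 * M) (M + i)) \<le> real (card R) * (\<Sum>i\<in>I. half_binom (2 * M) (M + i))"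
    using R by (intro mult_right_mono sum_nonneg) auto
  ultimately have "real d / 2 * (\<Sum>i\<in>I. half_binom (2 * M) (M + i)) \<le> 1" by linarith
  thus ?thesis using d by (simp add: I_def field_simps)
qed

text \<open>After exchanging the sums each divisor \<open>d\<close> contributes at most
  \<open>2 / d^2\<close>, which is summable.\<close>

lemma half_binom_inv_divisor_sum:
  fixes M :: nat
  shows "(\<Sum>i=1..M. half_binom (2 * M) (M + i) * inv_divisor_sum (2 * i)) \<le> 4"
proof -
  let ?b = "\<lambda>i. half_binom (2 * M) (M + i)"
  have eq: "inv_divisor_sum (2 * i) = (\<Sum>d=1..2*M. if d dvd 2 * i then 1 / real d else 0)" if "i \<in> {1..M}" for i
  proof -
    have "{d. d dvd 2 * i} = {d \<in> {1..2*M}. d dvd 2 * i}"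
      using that by (auto dest: dvd_imp_le intro!: Suc_leI Nat.gr0I)
    thus ?thesis unfolding inv_divisor_sum_def by (simp only: sum.inter_filter finite_atLeastAtMost)
  qed
  have "(\<Sum>i=1..M. ?b i * inv_divisor_sum (2 * i)) = (\<Sum>i=1..M. \<Sum>d=1..2*M. if d dvd 2 * i then 1 / real d * ?b i else 0)"
  proof (intro sum.cong refl)
    fix i assume "i \<in> {1..M}"
    show "?b i * inv_divisor_sum (2 * i) = (\<Sum>d=1..2*M. if d dvd 2 * i then 1 / real d * ?b i else 0)"
      unfolding eq[OF \<open>i \<in> {1..M}\<close>] sum_distrib_left by (intro sum.cong) auto
  qed
  also have "\<dots> = (\<Sum>d=1..2*M. 1 / real d * (\<Sum>i | i \<in> {1..M} \<and> d dvd 2 * i. ?b i))"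
    by (subst sum.swap, simp only: sum_distrib_left)
       (intro sum.cong refl sum.inter_filter[symmetric] finite_atLeastAtMost)
  also have "\<dots> \<le> (\<Sum>d=1..2*M. 1 / real d * (2 / real d))"
    by (intro sum_mono mult_left_mono half_binom_multiples_le) auto
  also have "\<dots> = 2 * (\<Sum>d=1..2*M. 1 / (real d)\<^sup>2)"
    by (simp add: sum_distrib_left power2_eq_square)
  also have "\<dots> \<le> 4" using sum_inverse_squares_le[of "2 * M"] by simp
  finally show ?thesis .
qed

lemma sum_split_symmetric:
  fixes f :: "nat \<Rightarrow> real"
  assumes sym: "\<And>i. i \<le> M \<Longrightarrow> f (M - i) = f (M + i)"
  shows "(\<Sum>k\<le>2 * M. f k) = f M + 2 * (\<Sum>i=1..M. f (M + i))"
proof -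
  have "{..2 * M} = {M} \<union> (\<lambda>i. M - i) ` {1..M} \<union> (\<lambda>i. M + i) ` {1..M}"
  proof (intro equalityI subsetI)
    fix k assume k: "k \<in> {..2 * M}"
    consider "k = M" | "k < M" | "k > M" by linarith
    thus "k \<in> {M} \<union> (\<lambda>i. M - i) ` {1..M} \<union> (\<lambda>i. M + i) ` {1..M}"
    proof cases
      case 2
      hence "k = M - (M - k)" "M - k \<in> {1..M}" by auto
      thus ?thesis by blast
    next
      case 3
      hence "k = M + (k - M)" "k - M \<in> {1..M}" using k by auto
      thus ?thesis by blast
    qed auto
  qed auto
  hence "(\<Sum>k\<le>2 * M. f k) = (\<Sum>k\<in>({M} \<union> (\<lambda>i. M - i) ` {1..M}) \<union> (\<lambda>i. M + i) ` {1..M}. f k)"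
    by simp
  also have "\<dots> = (\<Sum>k\<in>{M}. f k) + (\<Sum>k\<in>(\<lambda>i. M - i) ` {1..M}. f k) + (\<Sum>k\<in>(\<lambda>i. M + i) ` {1..M}. f k)"
    by (subst sum.union_disjoint; (subst sum.union_disjoint)?) auto
  also have "(\<Sum>k\<in>(\<lambda>i. M - i) ` {1..M}. f k) = (\<Sum>i=1..M. f (M + i))"
    by (subst sum.reindex) (auto simp: inj_on_def sym intro!: sum.cong)
  also have "(\<Sum>k\<in>(\<lambda>i. M + i) ` {1..M}. f k) = (\<Sum>i=1..M. f (M + i))"
    by (subst sum.reindex) (auto simp: inj_on_def)
  finally show ?thesis by simp
qed

text \<open>The index \<open>k = M\<close> is the zero increment, with weight at most
  \<open>2 / sqrt (2 * M)\<close>; hence \<open>2080 = 2 * 1040\<close>. The other increments come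
  in pairs of opposite sign, which gives \<open>117760 = 2 * 4 * 14720\<close>.\<close>

lemma prime_pair_prob_average:
  fixes n M :: nat
  assumes n: "n \<ge> 3" and M: "M \<ge> 1"
  defines "L \<equiv> ln (real n)"
  shows "(\<Sum>k\<le>2 * M. half_binom (2 * M) k * prime_pair_prob n (2 * int k - int (2 * M)))
           \<le> 2080 / (sqrt (real (2 * M)) * L) + 117760 / L\<^sup>2"
proof -
  have L: "L \<ge> 1" using ln_ge_1[OF n] by (simp add: L_def)
  define u where "u = (\<lambda>k. if k = M then 1040 / L
     else 14720 * inv_divisor_sum (nat \<bar>2 * int k - int (2 * M)\<bar>) / L\<^sup>2)"
  have "prime_pair_prob n (2 * int k - int (2 * M)) \<le> u k" for k
    using prime_pair_prob_le[OF n, of "2 * int k - int (2 * M)"] by (auto simp: u_def L_def)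
  hence "(\<Sum>k\<le>2 * M. half_binom (2 * M) k * prime_pair_prob n (2 * int k - int (2 * M)))
     \<le> (\<Sum>k\<le>2 * M. half_binom (2 * M) k * u k)"
    by (intro sum_mono mult_left_mono) auto
  also have "\<dots> = half_binom (2 * M) M * u M + 2 * (\<Sum>i=1..M. half_binom (2 * M) (M + i) * u (M + i))"
  proof (rule sum_split_symmetric)
    fix i assume i: "i \<le> M"
    have "half_binom (2 * M) (2 * M - (M + i)) = half_binom (2 * M) (M + i)"
      using i by (intro half_binom_symmetric) auto
    moreover have "u (M - i) = u (M + i)" using i by (auto simp: u_def of_nat_diff)
    ultimately show "half_binom (2 * M) (M - i) * u (M - i) = half_binom (2 * M) (M + i) * u (M + i)" by simp
  qed
  also have "(\<Sum>i=1..M. half_binom (2 * M) (M + i) * u (M + i))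
      = (\<Sum>i=1..M. 14720 / L\<^sup>2 * (half_binom (2 * M) (M + i) * inv_divisor_sum (2 * i)))"
    by (intro sum.cong) (auto simp: u_def nat_mult_distrib)
  also have "\<dots> = 14720 / L\<^sup>2 * (\<Sum>i=1..M. half_binom (2 * M) (M + i) * inv_divisor_sum (2 * i))"
    by (simp only: sum_distrib_left)
  also have "half_binom (2 * M) M * u M + 2 * \<dots>
      \<le> 2 / sqrt (real (2 * M)) * (1040 / L) + 2 * (14720 / L\<^sup>2 * 4)"
  proof (intro add_mono mult_left_mono half_binom_inv_divisor_sum)
    have "2 / sqrt (real (Suc (2 * M))) \<le> 2 / sqrt (real (2 * M))"
      using M by (intro divide_left_mono) auto
    hence "half_binom (2 * M) M \<le> 2 / sqrt (real (2 * M))"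
      using half_binom_le[of "2 * M" M] by linarith
    moreover have "u M = 1040 / L" by (simp add: u_def)
    ultimately show "half_binom (2 * M) M * u M \<le> 2 / sqrt (real (2 * M)) * (1040 / L)"
      using L by (simp only:) (intro mult_right_mono, auto)
  qed auto
  finally show ?thesis by simp
qed

subsection \<open>The random walk\<close>

lemma sum_Pow_card:
  fixes F :: "nat \<Rightarrow> real"
  assumes "finite U"
  shows "(\<Sum>A\<in>Pow U. F (card A)) = (\<Sum>j\<le>card U. real (card U choose j) * F j)"
proof -
  have "(\<Sum>A\<in>Pow U. F (card A)) = (\<Sum>j\<le>card U. \<Sum>A\<in>{A \<in> Pow U. card A = j}. F (card A))"
    using assms by (intro sum.group[symmetric]) (auto intro: card_mono)
  also have "\<dots> = (\<Sum>j\<le>card U. real (card U choose j) * F j)"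
  proof (intro sum.cong refl)
    fix j
    have "(\<Sum>A\<in>{A \<in> Pow U. card A = j}. F (card A)) = (\<Sum>A\<in>{A. A \<subseteq> U \<and> card A = j}. F j)"
      by (intro sum.cong) auto
    thus "(\<Sum>A\<in>{A \<in> Pow U. card A = j}. F (card A)) = real (card U choose j) * F j"
      using n_subsets[OF assms, of j] by simp
  qed
  finally show ?thesis .
qed

lemma sum_Pow_Un:
  fixes F :: "'b set \<Rightarrow> 'b set \<Rightarrow> real"
  assumes "U \<inter> V = {}"
  shows "(\<Sum>A\<in>Pow (U \<union> V). F (A \<inter> U) (A \<inter> V)) = (\<Sum>A\<in>Pow U. \<Sum>B\<in>Pow V. F A B)"
proof -
  have "(\<Sum>A\<in>Pow (U \<union> V). F (A \<inter> U) (A \<inter> V)) = (\<Sum>(A, B)\<in>Pow U \<times> Pow V. F A B)"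
    using assms
    by (intro sum.reindex_bij_witness[where i = "\<lambda>(A, B). A \<union> B" and j = "\<lambda>A. (A \<inter> U, A \<inter> V)"]) auto
  thus ?thesis by (simp add: sum.cartesian_product)
qed

lemma sum_signs:
  fixes A U :: "nat set"
  assumes "finite U"
  shows "(\<Sum>k\<in>U. if k \<in> A then 1 else - 1 :: int) = 2 * int (card (A \<inter> U)) - int (card U)"
proof -
  have "(\<Sum>k\<in>U. if k \<in> A then 1 else - 1 :: int) = (\<Sum>k\<in>U. 2 * of_bool (k \<in> A) - 1)"
    by (intro sum.cong) auto
  also have "\<dots> = 2 * (\<Sum>k\<in>U. of_bool (k \<in> A)) - int (card U)"
    by (simp add: sum_subtractf sum_distrib_left)
  also have "(\<Sum>k\<in>U. of_bool (k \<in> A)) = int (card (A \<inter> U))"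
    using assms by (simp add: Int_commute of_bool_def sum.inter_restrict[symmetric] flip: sum.inter_filter)
  finally show ?thesis .
qed

text \<open>The event on the left need not be known to be measurable: it is covered by finitely many sign
  patterns and a null set.\<close>

lemma rademacher_walk_joint_le:
  fixes M :: "'a measure" and X :: "nat \<Rightarrow> 'a \<Rightarrow> int" and Q :: "int \<Rightarrow> int \<Rightarrow> bool"
  assumes rad: "rademacher_seq M X" and N: "N \<ge> 1"
  shows "measure M {\<omega> \<in> space M. Q (rademacher_walk X n \<omega>) (rademacher_walk X (n + N) \<omega>)}
    \<le> (\<Sum>j\<le>n. \<Sum>k\<le>N. half_binom n j * half_binom N k *
         of_bool (Q (2 * int j - int n) (2 * int j - int n + (2 * int k - int N))))"
proof -
  interpret prob_space M using rad by (simp add: rademacher_seq_def)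
  define I where "I = {1..n + N}"
  define U where "U = {1..n}"
  define V where "V = {n + 1..n + N}"
  have I: "I = U \<union> V" "U \<inter> V = {}" by (auto simp: I_def U_def V_def)
  have fin: "finite U" "finite V" "finite I" by (auto simp: I_def U_def V_def)
  have cards: "card U = n" "card V = N" by (auto simp: U_def V_def)
  have indep: "indep_vars (\<lambda>_. count_space UNIV) X {1..}"
    using rad by (simp add: rademacher_seq_def)
  have rv: "X i \<in> measurable M (count_space UNIV)" if "i \<ge> 1" for i
    using indep that by (auto simp: indep_vars_def)
  \<comment> \<open>A subset of \<open>I\<close> encodes a sign pattern by the positions of its
    positive steps.\<close>
  define sg where "sg = (\<lambda>A (i::nat). if i \<in> A then 1 else - 1 :: int)"
  define atom where "atom = (\<lambda>A. \<Inter>i\<in>I. X i -` {sg A i} \<inter> space M)"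
  \<comment> \<open>\<open>N \<ge> 1\<close> makes \<open>I\<close> nonempty; an empty intersection
    would be \<open>UNIV\<close> instead of \<open>space M\<close>.\<close>
  have atom_iff: "\<omega> \<in> atom A \<longleftrightarrow> \<omega> \<in> space M \<and> (\<forall>i\<in>I. X i \<omega> = sg A i)" for \<omega> A
    using N by (auto simp: atom_def I_def)
  have atom_sets: "atom A \<in> events" for A
    unfolding atom_def using N fin
    by (intro sets.finite_INT measurable_sets[OF rv]) (auto simp: I_def)
  have atom_prob: "prob (atom A) = 1 / 2 ^ (n + N)" for A
  proof -
    have half: "prob (X i -` {sg A i} \<inter> space M) = 1 / 2" if "i \<in> I" for i
    proof -
      have "X i -` {c} \<inter> space M = {\<omega> \<in> space M. X i \<omega> = c}" for c by auto
      thus ?thesis using that rad by (auto simp: rademacher_seq_def I_def sg_def)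
    qed
    have "prob (atom A) = (\<Prod>i\<in>I. prob (X i -` {sg A i} \<inter> space M))"
      unfolding atom_def using N by (intro indep_varsD[OF indep]) (auto simp: I_def)
    also have "\<dots> = (\<Prod>i\<in>I. 1 / 2)" by (intro prod.cong refl half)
    finally show ?thesis by (simp add: I_def power_one_over)
  qed
  have disj: "disjoint_family_on atom (Pow I)"
  proof (unfold disjoint_family_on_def, intro ballI impI)
    fix A B assume AB: "A \<in> Pow I" "B \<in> Pow I" "A \<noteq> B"
    then obtain i where "i \<in> I" "i \<in> A \<longleftrightarrow> i \<notin> B" by blast
    hence "sg A i \<noteq> sg B i" "i \<in> I" by (auto simp: sg_def)
    thus "atom A \<inter> atom B = {}" unfolding disjoint_iff atom_iff by metis
  qed
  have union_prob: "prob (\<Union>A\<in>\<A>. atom A) = real (card \<A>) / 2 ^ (n + N)" if "\<A> \<subseteq> Pow I" for \<A>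
  proof -
    have "prob (\<Union>A\<in>\<A>. atom A) = (\<Sum>A\<in>\<A>. prob (atom A))"
      using that fin atom_sets
      by (intro finite_measure_finite_Union disjoint_family_on_mono[OF that disj])
         (auto intro: finite_subset)
    thus ?thesis by (simp add: atom_prob)
  qed
  \<comment> \<open>The outcomes where some step is neither 1 nor -1: a null set, as the
    \<open>2 ^ (n + N)\<close> disjoint atoms have total probability 1.\<close>
  define Z where "Z = space M - (\<Union>A\<in>Pow I. atom A)"
  have full_sets: "(\<Union>A\<in>\<A>. atom A) \<in> events" if "\<A> \<subseteq> Pow I" for \<A>
    using that fin atom_sets by (intro sets.finite_UN) (auto intro: finite_subset)
  have Z: "Z \<in> events" "prob Z = 0"
  proof -
    show "Z \<in> events" unfolding Z_def using full_sets[of "Pow I"] by auto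
    have "card (Pow I) = 2 ^ (n + N)" by (simp add: card_Pow I_def)
    thus "prob Z = 0"
      unfolding Z_def using full_sets[of "Pow I"] union_prob[of "Pow I"]
      by (subst prob_compl) auto
  qed
  define q where "q = (\<lambda>(A :: nat set) (B :: nat set). Q (2 * int (card A) - int n) (2 * int (card A) - int n + (2 * int (card B) - int N)))"
  define \<A> where "\<A> = {A \<in> Pow I. q (A \<inter> U) (A \<inter> V)}"
  have walk: "rademacher_walk X n \<omega> = 2 * int (card (A \<inter> U)) - int n \<and>
      rademacher_walk X (n + N) \<omega> = 2 * int (card (A \<inter> U)) - int n + (2 * int (card (A \<inter> V)) - int N)"
    if "\<omega> \<in> atom A" for \<omega> A
  proof -
    have X: "X i \<omega> = sg A i" if "i \<in> I" for i using \<open>\<omega> \<in> atom A\<close> that by (simp add: atom_iff)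
    have "(\<Sum>k\<in>U. X k \<omega>) = (\<Sum>k\<in>U. sg A k)" "(\<Sum>k\<in>V. X k \<omega>) = (\<Sum>k\<in>V. sg A k)"
      using X I by (auto intro!: sum.cong)
    hence S: "(\<Sum>k\<in>U. X k \<omega>) = 2 * int (card (A \<inter> U)) - int n"
        "(\<Sum>k\<in>V. X k \<omega>) = 2 * int (card (A \<inter> V)) - int N"
      using sum_signs[OF fin(1), of A] sum_signs[OF fin(2), of A] unfolding sg_def cards by auto
    have "(\<Sum>k\<in>I. X k \<omega>) = (\<Sum>k\<in>U. X k \<omega>) + (\<Sum>k\<in>V. X k \<omega>)"
      unfolding I(1) using fin I(2) by (intro sum.union_disjoint)
    thus ?thesis using S by (simp add: rademacher_walk_def U_def I_def)
  qed
  have "{\<omega> \<in> space M. Q (rademacher_walk X n \<omega>) (rademacher_walk X (n + N) \<omega>)} \<subseteq> (\<Union>A\<in>\<A>. atom A) \<union> Z"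
  proof
    fix \<omega> assume \<omega>: "\<omega> \<in> {\<omega> \<in> space M. Q (rademacher_walk X n \<omega>) (rademacher_walk X (n + N) \<omega>)}"
    show "\<omega> \<in> (\<Union>A\<in>\<A>. atom A) \<union> Z"
    proof (cases "\<exists>A\<in>Pow I. \<omega> \<in> atom A")
      case True
      then obtain A where A: "A \<in> Pow I" "\<omega> \<in> atom A" by blast
      have "q (A \<inter> U) (A \<inter> V)" using walk[OF A(2)] \<omega> by (simp add: q_def)
      thus ?thesis using A by (auto simp: \<A>_def)
    next
      case False
      thus ?thesis using \<omega> by (auto simp: Z_def)
    qed
  qed
  hence "prob {\<omega> \<in> space M. Q (rademacher_walk X n \<omega>) (rademacher_walk X (n + N) \<omega>)} \<le> prob ((\<Union>A\<in>\<A>. atom A) \<union> Z)"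
    using full_sets[of \<A>] Z(1) by (intro finite_measure_mono) (auto simp: \<A>_def)
  also have "\<dots> \<le> prob (\<Union>A\<in>\<A>. atom A) + prob Z"
    using full_sets[of \<A>] Z(1) by (intro measure_Un_le) (auto simp: \<A>_def)
  also have "\<dots> = real (card \<A>) / 2 ^ (n + N)"
    using union_prob[of \<A>] Z(2) by (auto simp: \<A>_def)
  also have "real (card \<A>) = (\<Sum>A\<in>Pow (U \<union> V). of_bool (q (A \<inter> U) (A \<inter> V)))"
  proof -
    have "(\<Sum>A\<in>Pow I. of_bool (q (A \<inter> U) (A \<inter> V))) = (\<Sum>A\<in>\<A>. 1::real)"
      unfolding \<A>_def using fin by (intro sum.mono_neutral_cong_right) auto
    thus ?thesis by (simp add: I(1))
  qed
  also have "\<dots> = (\<Sum>A\<in>Pow U. \<Sum>B\<in>Pow V. of_bool (q A B))"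
    by (rule sum_Pow_Un[OF I(2)])
  also have "\<dots> = (\<Sum>j\<le>n. real (n choose j) * (\<Sum>k\<le>N. real (N choose k) *
      of_bool (Q (2 * int j - int n) (2 * int j - int n + (2 * int k - int N)))))"
    unfolding q_def
    by (subst sum_Pow_card[OF fin(2)], subst sum_Pow_card[OF fin(1)]) (simp only: cards)
  also have "\<dots> / 2 ^ (n + N) = (\<Sum>j\<le>n. \<Sum>k\<le>N. half_binom n j * half_binom N k *
      of_bool (Q (2 * int j - int n) (2 * int j - int n + (2 * int k - int N))))"
    unfolding sum_distrib_left sum_divide_distrib half_binom_def
    by (intro sum.cong refl) (simp add: power_add)
  finally show ?thesis .
qed

theorem theorem7p6:
  shows "\<exists>C :: real. \<forall>\<epsilon> > (0::real). \<exists>C\<^sub>\<epsilon> :: real.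
    \<forall>(M :: 'a measure) (X :: nat \<Rightarrow> 'a \<Rightarrow> int). rademacher_seq M X \<longrightarrow>
      (\<forall>m n :: nat. odd m \<longrightarrow> odd n \<longrightarrow> m > n \<longrightarrow> n \<ge> 3 \<longrightarrow>
        measure M {\<omega> \<in> space M. abs_prime (rademacher_walk X n \<omega>) \<and>
                                abs_prime (rademacher_walk X m \<omega>)}
        \<le> C / (sqrt (real m - real n) * ln (real n))
          + C\<^sub>\<epsilon> * real n powr (- 1 / 2 + \<epsilon>)
          + C * ln (log_plus (real m - real n)) / (ln (real n))\<^sup>2)"
proof -
  \<comment> \<open>The value of log log at 4, the least even difference above 2.\<close>
  define c where "c = ln (ln (4 :: real))"
  have ln4: "ln (4::real) > 1"
  proof -
    have "exp (1::real) < 4" using exp_le by linarith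
    hence "ln (exp (1::real)) < ln 4" by (subst ln_less_cancel_iff) auto
    thus ?thesis by simp
  qed
  hence c: "c > 0" by (simp add: c_def)
  \<comment> \<open>400000 exceeds \<open>2080 + 2 * 117760\<close>, needed for difference 2; the
    summand \<open>117760 / c\<close> serves all larger differences.\<close>
  define C where "C = 400000 + 117760 / c"
  have C: "C \<ge> 400000" "C * c \<ge> 117760" using c by (auto simp: C_def field_simps)
  have bound: "measure M {\<omega> \<in> space M. abs_prime (rademacher_walk X n \<omega>) \<and> abs_prime (rademacher_walk X m \<omega>)}
      \<le> C / (sqrt (real m - real n) * ln (real n)) + C * ln (log_plus (real m - real n)) / (ln (real n))\<^sup>2"
    if rad: "rademacher_seq M X" and mn: "odd m" "odd n" "m > n" "n \<ge> 3"
    for M :: "'a measure" and X :: "nat \<Rightarrow> 'a \<Rightarrow> int" and m n :: nat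
  proof -
    define L where "L = ln (real n)"
    have L: "L \<ge> 1" using ln_ge_1[OF mn(4)] by (simp add: L_def)
    have "even (m - n)" using mn by simp
    then obtain K where K: "m - n = 2 * K" by (elim evenE)
    have m: "m = n + 2 * K" and K1: "K \<ge> 1" using K mn by auto
    have diff: "real m - real n = real (2 * K)" unfolding m by simp
    define r where "r = sqrt (real (2 * K))"
    have r: "r > 0" using K1 by (simp add: r_def)
    have "measure M {\<omega> \<in> space M. abs_prime (rademacher_walk X n \<omega>) \<and> abs_prime (rademacher_walk X m \<omega>)}
      \<le> (\<Sum>j\<le>n. \<Sum>k\<le>2 * K. half_binom n j * half_binom (2 * K) k *
         of_bool (abs_prime (2 * int j - int n) \<and> abs_prime (2 * int j - int n + (2 * int k - int (2 * K)))))"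
      unfolding m using K1 rademacher_walk_joint_le[OF rad, of "2 * K" "\<lambda>x y. abs_prime x \<and> abs_prime y" n] by simp
    also have "\<dots> = (\<Sum>k\<le>2 * K. half_binom (2 * K) k * prime_pair_prob n (2 * int k - int (2 * K)))"
      by (subst sum.swap) (simp only: prime_pair_prob_def sum_distrib_left mult_ac)
    also have "\<dots> \<le> 2080 / (r * L) + 117760 / L\<^sup>2"
      unfolding L_def r_def by (rule prime_pair_prob_average[OF mn(4) K1])
    also have "\<dots> \<le> C / (r * L) + C * ln (log_plus (real (2 * K))) / L\<^sup>2"
    proof (cases "K = 1")
      case True
      \<comment> \<open>For difference 2 the square root is bounded, so
        \<open>1 / L^2 \<le> 1 / L\<close> fits under the first summand.\<close>
      have r2: "r \<le> 2" unfolding r_def using True by (intro real_le_lsqrt) auto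
      have "ln (log_plus (real (2 * K))) \<ge> 0" by (auto simp: log_plus_def)
      moreover have "117760 / L\<^sup>2 \<le> 2 * 117760 / (r * L)"
      proof -
        have "117760 / L\<^sup>2 \<le> 117760 / L" using L by (intro divide_left_mono) (auto simp: power2_eq_square)
        also have "\<dots> = 2 * 117760 / (2 * L)" by simp
        also have "\<dots> \<le> 2 * 117760 / (r * L)" using r r2 L by (intro divide_left_mono mult_right_mono) auto
        finally show ?thesis .
      qed
      moreover have "2080 / (r * L) + 2 * 117760 / (r * L) \<le> C / (r * L)"
        unfolding add_divide_distrib[symmetric] using C r L by (intro divide_right_mono) auto
      moreover have "C * ln (log_plus (real (2 * K))) / L\<^sup>2 \<ge> 0"
        using C calculation(1) by simp
      ultimately show ?thesis by linarith
    next
      case False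
      hence "4 \<le> real (2 * K)" using K1 by linarith
      hence "ln 4 \<le> log_plus (real (2 * K))"
        unfolding log_plus_def by (intro max.coboundedI2) (subst ln_le_cancel_iff, auto)
      hence "c \<le> ln (log_plus (real (2 * K)))"
        unfolding c_def using ln4 by (subst ln_le_cancel_iff) auto
      hence "C * c \<le> C * ln (log_plus (real (2 * K)))" using C by (intro mult_left_mono) auto
      hence "117760 \<le> C * ln (log_plus (real (2 * K)))" using C by linarith
      thus ?thesis using C r L by (intro add_mono divide_right_mono) auto
    qed
    finally show ?thesis unfolding diff r_def L_def .
  qed
  show ?thesis
    by (rule exI[of _ C], intro allI impI, rule exI[of _ 0], intro allI impI) (use bound in simp)
qed

end
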